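(* Let $\mathbf{A}=[\underline{A},\overline{A}]$ be an $n\times n$ real interval matrix that is totally positive. Then $\lambda_n(\mathbf{A})=[\lambda_n(\downarrow A),\lambda_n(\uparrow A)]$ and $\lambda_1(\mathbf{A})=[\lambda_1(\underline{A}),\lambda_1(\overline{A})]$.
   Context: Inequalities between matrices are entrywise. For $\underline{A}\le\overline{A}$ in $\mathbb{R}^{n\times n}$, the interval matrix is $\mathbf{A}=\{A\in\mathbb{R}^{n\times n} : \underline{A}\le A\le\overline{A}\}$, with midpoint $A^c=\frac12(\underline{A}+\overline{A})$ and radius $A^\Delta=\frac12(\overline{A}-\underline{A})$. A matrix in $\mathbb{R}^{n\times n}$ is totally positive if the determinants of all its square submatrices (all minors) are positive; $\mathbf{A}$ is totally positive if every $A\in\mathbf{A}$ is. A totally positive matrix $A$ (not necessarily symmetric) has distinct positive real eigenvalues, denoted $\lambda_1(A)>\dots>\lambda_n(A)>0$. Let $s=(1,-1,1,-1,\dots)^T\in\mathbb{R}^n$, let $\operatorname{diag}(s)$ be the diagonal matrix with diagonal $s$, and put $\downarrow A=A^c-\operatorname{diag}(s)A^\Delta\operatorname{diag}(s)$, $\uparrow A=A^c+\operatorname{diag}(s)A^\Delta\operatorname{diag}(s)$. For each $i$, $\lambda_i(\mathbf{A})=\{\lambda_i(A) : A\in\mathbf{A}\}$. *)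

theory Defs
  imports "Jordan_Normal_Form.DL_Submatrix" "Jordan_Normal_Form.Spectral_Radius"
begin

text \<open>
  The order on matrices of equal dimensions is entrywise, so the interval matrix with bounds
  \<open>L \<le> U\<close> is the order interval \<open>{L..U}\<close>.
\<close>

definition midpoint_mat :: "real mat \<Rightarrow> real mat \<Rightarrow> real mat" where
  "midpoint_mat L U = (1 / 2) \<cdot>\<^sub>m (L + U)"

definition radius_mat :: "real mat \<Rightarrow> real mat \<Rightarrow> real mat" where
  "radius_mat L U = (1 / 2) \<cdot>\<^sub>m (U - L)"

text \<open>
  Indices start at \<open>0\<close>, so the alternating vector \<open>(1, -1, 1, \<dots>)\<close> has entries \<open>(-1) ^ i\<close>.
\<close>

definition alternating_diag :: "nat \<Rightarrow> real mat" where
  "alternating_diag n = mat_diag n (\<lambda>i. (- 1) ^ i)"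

definition down_mat :: "real mat \<Rightarrow> real mat \<Rightarrow> real mat" where
  "down_mat L U = midpoint_mat L U -
     alternating_diag (dim_row L) * radius_mat L U * alternating_diag (dim_row L)"

definition up_mat :: "real mat \<Rightarrow> real mat \<Rightarrow> real mat" where
  "up_mat L U = midpoint_mat L U +
     alternating_diag (dim_row L) * radius_mat L U * alternating_diag (dim_row L)"

definition totally_positive :: "real mat \<Rightarrow> bool" where
  "totally_positive A \<longleftrightarrow> square_mat A \<and>
     (\<forall>I J. I \<subseteq> {..<dim_row A} \<and> J \<subseteq> {..<dim_row A} \<and> I \<noteq> {} \<and> card I = card J
        \<longrightarrow> 0 < det (submatrix A I J))"

definition totally_positive_interval :: "real mat \<Rightarrow> real mat \<Rightarrow> bool" where
  "totally_positive_interval L U \<longleftrightarrow> (\<forall>A \<in> {L..U}. totally_positive A)"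

text \<open>
  The \<open>i\<close>-th largest real eigenvalue, with \<open>i\<close> counted from \<open>1\<close>. It is meaningful only when the
  matrix has at least \<open>i\<close> distinct real eigenvalues; a totally positive \<open>n \<times> n\<close> matrix
  has \<open>n\<close> of them.
\<close>

definition eig :: "nat \<Rightarrow> real mat \<Rightarrow> real" where
  "eig i A = rev (sorted_list_of_set (spectrum A)) ! (i - 1)"

definition eig_range :: "nat \<Rightarrow> real mat \<Rightarrow> real mat \<Rightarrow> real set" where
  "eig_range i L U = {eig i A | A. A \<in> {L..U}}"

end

theory Submission
  imports Defs
begin

text \<open>
  Let \<open>q\<^sub>l\<close> be the characteristic polynomial of the leading \<open>l \<times> l\<close> block of a totally positive
  matrix \<open>A\<close>, and \<open>r\<^sub>l\<close> that of the \<open>l \<times> l\<close> block starting at the second row and column. The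
  Desnanot-Jacobi identity for \<open>x I - A\<close> expresses \<open>r\<^sub>l\<^sub>+\<^sub>1 q\<^sub>l\<^sub>+\<^sub>1 - q\<^sub>l\<^sub>+\<^sub>2 r\<^sub>l\<close> as a product of two minors in
  which \<open>x\<close> occurs only next to the diagonal. Up to a common sign these are polynomials in \<open>x\<close> whose
  coefficients are sums of minors of \<open>A\<close>, so the product is positive for \<open>x > 0\<close>. Hence at the
  roots of \<open>q\<^sub>l\<^sub>+\<^sub>1\<close> the signs of \<open>q\<^sub>l\<^sub>+\<^sub>2\<close> are opposite to those of \<open>r\<^sub>l\<close>, and by induction all
  eigenvalues are simple and positive.

  With a simple positive spectrum, \<open>tr A\<^sup>k = \<Sum> \<lambda>\<^sup>k\<close>, so comparing traces of powers shows that the largest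
  eigenvalue is monotone under entrywise comparison of nonnegative matrices, and also that it is
  continuous. Conjugation by the alternating diagonal makes the inverse of \<open>A\<close> entrywise positive, and
  this conjugated inverse is antitone in the checkerboard order, whose extreme elements in the
  interval are \<open>down_mat\<close> and \<open>up_mat\<close>. This gives the statement for the smallest eigenvalue.
\<close>

section \<open>Corner minors and the Desnanot-Jacobi identity\<close>

text \<open>Rows and columns are chosen by increasing maps rather than by sets, so that deleting one
  of them is composition with \<open>insert_index\<close>. For \<open>k = 0\<close> the condition
  concerns the empty determinant, which is \<open>1\<close>.\<close>

definition minors_pos :: "nat \<Rightarrow> (nat \<Rightarrow> nat \<Rightarrow> real) \<Rightarrow> bool" where
  "minors_pos n a \<longleftrightarrow> (\<forall>k r c. strict_mono_on {..<k} r \<and> r ` {..<k} \<subseteq> {..<n} \<and>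
     strict_mono_on {..<k} c \<and> c ` {..<k} \<subseteq> {..<n} \<longrightarrow>
     0 < det (mat k k (\<lambda>(i, j). a (r i) (c j))))"

text \<open>Exactly \<open>i\<close> elements of the image lie below \<open>r i\<close>, so
  \<open>pick\<close>, on which \<open>submatrix\<close> rests, enumerates the image in the same
  order as \<open>r\<close>.\<close>

lemma pick_image_strict_mono:
  assumes r: "strict_mono_on {..<k} r" and i: "i < k"
  shows "pick (r ` {..<k}) i = r i"
proof -
  have inj: "inj_on r {..<k}"
    using r by (simp add: strict_mono_on_imp_inj_on)
  have "{a \<in> r ` {..<k}. a < r i} = r ` {..<i}"
    using strict_mono_on_less[OF r] i by (auto simp: image_iff)
  moreover have "card (r ` {..<i}) = i"
    using card_image[OF inj_on_subset[OF inj, of "{..<i}"]] i by auto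
  ultimately show ?thesis
    using pick_card_in_set[of "r i" "r ` {..<k}"] i by auto
qed

lemma totally_positive_imp_minors_pos:
  assumes A: "A \<in> carrier_mat n n" and tp: "totally_positive A"
  shows "minors_pos n (\<lambda>i j. A $$ (i, j))"
  unfolding minors_pos_def
proof (intro allI impI, elim conjE)
  fix k :: nat and r c :: "nat \<Rightarrow> nat"
  assume r: "strict_mono_on {..<k} r" "r ` {..<k} \<subseteq> {..<n}"
    and c: "strict_mono_on {..<k} c" "c ` {..<k} \<subseteq> {..<n}"
  show "0 < det (mat k k (\<lambda>(i, j). A $$ (r i, c j)))"
  \<comment> \<open>\<open>totally_positive\<close> speaks of nonempty index sets only; the empty
    minor is \<open>1\<close>.\<close>
  proof (cases "k = 0")
    case True
    then show ?thesis by (simp add: det_dim_zero)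
  next
    case False
    have inj: "inj_on r {..<k}" "inj_on c {..<k}"
      using r c by (simp_all add: strict_mono_on_imp_inj_on)
    have card: "card (r ` {..<k}) = k" "card (c ` {..<k}) = k"
      using card_image[OF inj(1)] card_image[OF inj(2)] by simp_all
    have sets: "{i. i < n \<and> i \<in> r ` {..<k}} = r ` {..<k}" "{i. i < n \<and> i \<in> c ` {..<k}} = c ` {..<k}"
      using r c by auto
    have "submatrix A (r ` {..<k}) (c ` {..<k}) = mat k k (\<lambda>(i, j). A $$ (r i, c j))"
      using A card sets pick_image_strict_mono[OF r(1)] pick_image_strict_mono[OF c(1)]
      by (intro eq_matI) (auto simp: submatrix_def)
    moreover have "0 < det (submatrix A (r ` {..<k}) (c ` {..<k}))"
    proof -
      have "r ` {..<k} \<noteq> {}" using False by (simp add: lessThan_empty_iff)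
      then show ?thesis
        using tp A r(2) c(2) card by (simp only: totally_positive_def carrier_matD) metis
    qed
    ultimately show ?thesis by simp
  qed
qed

lemma minors_pos_swap:
  assumes "minors_pos n a"
  shows "minors_pos n (\<lambda>i j. a j i)"
  unfolding minors_pos_def
proof (intro allI impI, elim conjE)
  fix k :: nat and r c :: "nat \<Rightarrow> nat"
  assume r: "strict_mono_on {..<k} r" "r ` {..<k} \<subseteq> {..<n}"
    and c: "strict_mono_on {..<k} c" "c ` {..<k} \<subseteq> {..<n}"
  have "mat k k (\<lambda>(i, j). a (c j) (r i)) = (mat k k (\<lambda>(i, j). a (c i) (r j)))\<^sup>T"
    by auto
  moreover have "0 < det (mat k k (\<lambda>(i, j). a (c i) (r j)))"
    using assms r c unfolding minors_pos_def by blast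
  ultimately show "0 < det (mat k k (\<lambda>(i, j). a (c j) (r i)))"
    by (simp add: det_transpose[of _ k])
qed

section \<open>Minors with a shift next to the diagonal\<close>

lemma mat_delete_mat:
  "mat_delete (mat (Suc m) (Suc m) f) i j = mat m m (\<lambda>(p, q). f (insert_index i p, insert_index j q))"
  by (rule eq_matI) (auto simp: mat_delete_def insert_index_def)

lemma insert_index_strict_mono_on:
  assumes "strict_mono_on {..<Suc m} r"
  shows "strict_mono_on {..<m} (r \<circ> insert_index i)"
  using assms by (auto simp: strict_mono_on_def insert_index_def)

lemma insert_index_image_subset:
  assumes "r ` {..<Suc m} \<subseteq> {..<n}"
  shows "(r \<circ> insert_index i) ` {..<m} \<subseteq> {..<n}"
proof -
  have "r (insert_index i p) \<in> {..<n}" if "p < m" for p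
    by (rule subsetD[OF assms], rule imageI) (use that in \<open>auto simp: insert_index_def\<close>)
  then show ?thesis by auto
qed

text \<open>
  Expanding along row \<open>k\<close>, the entry \<open>- x\<close> contributes \<open>x\<close> times a smaller determinant of the same kind.
\<close>

lemma det_superdiagonal_shift_pos:
  assumes a: "minors_pos n a" and x: "0 \<le> x"
    and "strict_mono_on {..<m} r" "r ` {..<m} \<subseteq> {..<n}"
    and "strict_mono_on {..<m} c" "c ` {..<m} \<subseteq> {..<n}" and "k < m"
  shows "0 < det (mat m m (\<lambda>(p, q). a (r p) (c q) - (if p < k \<and> q = Suc p then x else 0)))"
  using assms(3-)
proof (induction k arbitrary: m r c)
  case 0
  then show ?case using a by (simp add: minors_pos_def)
next
  case (Suc k)
  obtain l where m: "m = Suc l" and kl: "k < l"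
    using Suc.prems(5) by (cases m) auto
  define N where "N k = mat m m (\<lambda>(p, q). a (r p) (c q) - (if p < k \<and> q = Suc p then x else 0))" for k
  have N: "N k \<in> carrier_mat m m" for k by (simp add: N_def)
  have pos: "0 < det (N k)" unfolding N_def using Suc.prems by (intro Suc.IH) simp_all
  \<comment> \<open>Deleting row \<open>k\<close> and column \<open>Suc k\<close> leaves the shifted
    places \<open>(p, Suc p)\<close> with \<open>p < k\<close> where they were, so the induction
    hypothesis applies to this minor too.\<close>
  have del: "mat_delete (N k) k (Suc k) = mat l l (\<lambda>(p, q). a ((r \<circ> insert_index k) p)
      ((c \<circ> insert_index (Suc k)) q) - (if p < k \<and> q = Suc p then x else 0))"
    unfolding N_def m mat_delete_mat by (intro eq_matI) (auto simp: insert_index_def)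
  have pos': "0 < det (mat_delete (N k) k (Suc k))"
    unfolding del using Suc.prems kl
    by (intro Suc.IH insert_index_strict_mono_on insert_index_image_subset) (simp_all only: m)
  \<comment> \<open>The two matrices differ in row \<open>k\<close> only, which the cofactors of
    that row do not see.\<close>
  have cof: "cofactor (N (Suc k)) k j = cofactor (N k) k j" for j
    unfolding cofactor_def N_def m mat_delete_mat
    by (intro arg_cong2[where f = "(*)"] arg_cong[where f = det] eq_matI)
      (auto simp: insert_index_def)
  have "det (N (Suc k)) = (\<Sum>j<m. N (Suc k) $$ (k, j) * cofactor (N k) k j)"
    using laplace_expansion_row[OF N, of k "Suc k"] kl m by (simp add: cof)
  also have "\<dots> = (\<Sum>j<m. N k $$ (k, j) * cofactor (N k) k j - (if j = Suc k then x * cofactor (N k) k j else 0))"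
    using kl m by (intro sum.cong) (auto simp: N_def algebra_simps)
  also have "\<dots> = det (N k) - x * cofactor (N k) k (Suc k)"
    using laplace_expansion_row[OF N, of k k] kl m by (simp add: sum_subtractf)
  \<comment> \<open>The cofactor sign at \<open>(k, Suc k)\<close> is \<open>-1\<close>, which turns
    the subtracted \<open>x\<close> into a positive contribution.\<close>
  also have "\<dots> = det (N k) + x * det (mat_delete (N k) k (Suc k))"
    by (simp add: cofactor_def)
  finally have "0 < det (N (Suc k))"
    using pos pos' x by (simp add: add_pos_nonneg)
  then show ?case by (simp add: N_def)
qed

text \<open>Expanding along the inner unit columns leaves the 2 by 2 determinant of the corners.
  With columns of an adjugate as \<open>u\<close> and \<open>v\<close>, this becomes the right-hand
  side of the Desnanot-Jacobi identity.\<close>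

lemma det_inner_identity_columns:
  fixes u v :: "nat \<Rightarrow> 'a :: comm_ring_1"
  shows "det (mat (Suc (Suc m)) (Suc (Suc m)) (\<lambda>(i, j). if j = 0 then u i
      else if j = Suc m then v i else if i = j then 1 else 0)) = u 0 * v (Suc m) - u (Suc m) * v 0"
proof (induction m arbitrary: u v)
  case 0
  show ?case
    by (subst laplace_expansion_column[of _ 2 0])
      (auto simp: numeral_2_eq_2 cofactor_def mat_delete_mat insert_index_def det_single)
next
  case (Suc m)
  let ?X = "mat (Suc (Suc (Suc m))) (Suc (Suc (Suc m))) (\<lambda>(i, j). if j = 0 then u i
      else if j = Suc (Suc m) then v i else if i = j then 1 else 0)"
  have "det ?X = (\<Sum>i<Suc (Suc (Suc m)). ?X $$ (i, 1) * cofactor ?X i 1)"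
    by (rule laplace_expansion_column) auto
  also have "\<dots> = (\<Sum>i<Suc (Suc (Suc m)). if i = 1 then cofactor ?X i 1 else 0)"
    by (intro sum.cong) auto
  also have "\<dots> = cofactor ?X 1 1" by simp
  also have "\<dots> = det (mat (Suc (Suc m)) (Suc (Suc m)) (\<lambda>(i, j). if j = 0 then (u \<circ> insert_index 1) i
      else if j = Suc m then (v \<circ> insert_index 1) i else if i = j then 1 else 0))"
    unfolding cofactor_def mat_delete_mat
    by (simp, intro arg_cong[where f = det] eq_matI) (auto simp: insert_index_def)
  also have "\<dots> = u 0 * v (Suc (Suc m)) - u (Suc (Suc m)) * v 0"
    unfolding Suc.IH by simp
  finally show ?case .
qed

text \<open>Such outer columns arise when a matrix with determinant \<open>d\<close> is multiplied
  by the outer columns of its adjugate; expanding along them leaves the inner block.\<close>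

lemma det_outer_unit_columns:
  fixes d :: "'a :: comm_ring_1"
  shows "det (mat (Suc (Suc m)) (Suc (Suc m)) (\<lambda>(i, j). if j = 0 then (if i = 0 then d else 0)
      else if j = Suc m then (if i = Suc m then d else 0) else f (i, j))) =
    d * (d * det (mat m m (\<lambda>(i, j). f (Suc i, Suc j))))"
    (is "det ?Y = _")
proof -
  let ?Z = "mat (Suc m) (Suc m) (\<lambda>(i, j). if j = m then (if i = m then d else 0) else f (Suc i, Suc j))"
  have "det ?Y = (\<Sum>i<Suc (Suc m). ?Y $$ (i, 0) * cofactor ?Y i 0)"
    by (rule laplace_expansion_column) auto
  also have "\<dots> = (\<Sum>i<Suc (Suc m). if i = 0 then d * cofactor ?Y i 0 else 0)"
    by (intro sum.cong) auto
  also have "\<dots> = d * cofactor ?Y 0 0" by simp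
  also have "cofactor ?Y 0 0 = det ?Z"
    unfolding cofactor_def mat_delete_mat
    by (simp, intro arg_cong[where f = det] eq_matI) (auto simp: insert_index_def)
  also have "det ?Z = (\<Sum>i<Suc m. ?Z $$ (i, m) * cofactor ?Z i m)"
    by (rule laplace_expansion_column) auto
  also have "\<dots> = (\<Sum>i<Suc m. if i = m then d * cofactor ?Z i m else 0)"
    by (intro sum.cong) auto
  also have "\<dots> = d * cofactor ?Z m m" by simp
  also have "cofactor ?Z m m = det (mat m m (\<lambda>(i, j). f (Suc i, Suc j)))"
    unfolding cofactor_def mat_delete_mat
    by (simp, intro arg_cong[where f = det] eq_matI) (auto simp: insert_index_def)
  finally show ?thesis .
qed

text \<open>Replace the outer columns of the identity by those of the adjugate. Multiplication by
  \<open>M\<close> turns them into \<open>det M\<close> times unit vectors, and comparing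
  determinants gives the identity multiplied by \<open>det M\<close>, which can be
  cancelled.\<close>

lemma desnanot_jacobi_nonsingular:
  fixes M :: "'a :: idom mat"
  assumes M: "M \<in> carrier_mat (Suc (Suc m)) (Suc (Suc m))" and nz: "det M \<noteq> 0"
  shows "det M * det (mat m m (\<lambda>(i, j). M $$ (Suc i, Suc j))) =
    det (mat (Suc m) (Suc m) (\<lambda>(i, j). M $$ (Suc i, Suc j))) *
      det (mat (Suc m) (Suc m) (\<lambda>(i, j). M $$ (i, j))) -
    det (mat (Suc m) (Suc m) (\<lambda>(i, j). M $$ (Suc i, j))) *
      det (mat (Suc m) (Suc m) (\<lambda>(i, j). M $$ (i, Suc j)))"
proof -
  let ?n = "Suc (Suc m)"
  define u where "u i = cofactor M 0 i" for i
  define v where "v i = cofactor M (Suc m) i" for i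
  define X where "X = mat ?n ?n (\<lambda>(i, j). if j = 0 then u i else if j = Suc m then v i
    else if i = j then 1 else 0)"
  define Y where "Y = mat ?n ?n (\<lambda>(i, j). if j = 0 then (if i = 0 then det M else 0)
    else if j = Suc m then (if i = Suc m then det M else 0) else M $$ (i, j))"
  have X: "X \<in> carrier_mat ?n ?n" by (simp add: X_def)
  have adj: "(\<Sum>k<?n. M $$ (i, k) * cofactor M j k) = (if i = j then det M else 0)"
    if "i < ?n" "j < ?n" for i j
  proof -
    have "(M * adj_mat M) $$ (i, j) = (\<Sum>k<?n. M $$ (i, k) * cofactor M j k)"
      using M that by (auto simp: scalar_prod_def adj_mat_def atLeast0LessThan intro!: sum.cong)
    moreover have "(M * adj_mat M) $$ (i, j) = (if i = j then det M else 0)"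
      unfolding adj_mat(2)[OF M] using that by simp
    ultimately show ?thesis by (simp only:)
  qed
  \<comment> \<open>\<open>X\<close> is the identity with its outer columns replaced by those of the adjugate of \<open>M\<close>.\<close>
  have "M * X = Y"
  proof (rule eq_matI)
    fix i j assume "i < dim_row Y" "j < dim_col Y"
    then have ij: "i < ?n" "j < ?n" by (auto simp: Y_def)
    have "(M * X) $$ (i, j) = (\<Sum>k<?n. M $$ (i, k) * X $$ (k, j))"
      using M X ij by (auto simp: scalar_prod_def atLeast0LessThan intro!: sum.cong)
    also have "\<dots> = Y $$ (i, j)"
    proof (cases "j = 0 \<or> j = Suc m")
      case True
      then have "(\<Sum>k<?n. M $$ (i, k) * X $$ (k, j)) = (\<Sum>k<?n. M $$ (i, k) * cofactor M j k)"
        using ij by (intro sum.cong) (auto simp: X_def u_def v_def)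
      then show ?thesis using adj[OF ij] True ij by (auto simp: Y_def)
    next
      case False
      then have "(\<Sum>k<?n. M $$ (i, k) * X $$ (k, j)) = (\<Sum>k<?n. if k = j then M $$ (i, k) else 0)"
        using ij by (intro sum.cong) (auto simp: X_def)
      then show ?thesis using False ij by (simp add: Y_def)
    qed
    finally show "(M * X) $$ (i, j) = Y $$ (i, j)" .
  qed (use M in \<open>auto simp: X_def Y_def\<close>)
  then have "det M * det X = det Y"
    using det_mult[OF M X] by simp
  then have "det M * (u 0 * v (Suc m) - u (Suc m) * v 0) =
      det M * (det M * det (mat m m (\<lambda>(i, j). M $$ (Suc i, Suc j))))"
    unfolding X_def Y_def det_inner_identity_columns det_outer_unit_columns .
  then have main: "u 0 * v (Suc m) - u (Suc m) * v 0 =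
      det M * det (mat m m (\<lambda>(i, j). M $$ (Suc i, Suc j)))"
    using nz by simp
  have del: "mat_delete M i j = mat (Suc m) (Suc m) (\<lambda>(p, q). M $$ (insert_index i p, insert_index j q))"
    for i j
    using M by (intro eq_matI) (auto simp: mat_delete_def insert_index_def)
  have m: "mat (Suc m) (Suc m) (\<lambda>(p, q). M $$ (insert_index (Suc m) p, insert_index (Suc m) q)) =
      mat (Suc m) (Suc m) (\<lambda>(i, j). M $$ (i, j))"
    "mat (Suc m) (Suc m) (\<lambda>(p, q). M $$ (Suc p, insert_index (Suc m) q)) =
      mat (Suc m) (Suc m) (\<lambda>(i, j). M $$ (Suc i, j))"
    "mat (Suc m) (Suc m) (\<lambda>(p, q). M $$ (insert_index (Suc m) p, Suc q)) =
      mat (Suc m) (Suc m) (\<lambda>(i, j). M $$ (i, Suc j))"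
    by (auto intro!: eq_matI)
  \<comment> \<open>The cofactors at the two off-diagonal corners each carry the sign
    \<open>(- 1) ^ Suc m\<close>; it disappears from their product.\<close>
  have sq: "(- 1 :: 'a) ^ Suc m * y * ((- 1) ^ Suc m * z) = y * z" for y z
  proof -
    have "(- 1 :: 'a) ^ Suc m * y * ((- 1) ^ Suc m * z) = (- 1) ^ (Suc m + Suc m) * (y * z)"
      by (simp only: power_add mult.assoc mult.left_commute)
    then show ?thesis by (simp flip: mult_2 power_mult)
  qed
  show ?thesis
    unfolding main[symmetric] u_def v_def cofactor_def del
    using sq by (simp add: m flip: mult_2)
qed

lemma desnanot_jacobi:
  fixes M :: "'a :: idom mat"
  assumes M: "M \<in> carrier_mat (Suc (Suc m)) (Suc (Suc m))"
  shows "det M * det (mat m m (\<lambda>(i, j). M $$ (Suc i, Suc j))) =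
    det (mat (Suc m) (Suc m) (\<lambda>(i, j). M $$ (Suc i, Suc j))) *
      det (mat (Suc m) (Suc m) (\<lambda>(i, j). M $$ (i, j))) -
    det (mat (Suc m) (Suc m) (\<lambda>(i, j). M $$ (Suc i, j))) *
      det (mat (Suc m) (Suc m) (\<lambda>(i, j). M $$ (i, Suc j)))"
proof -
  \<comment> \<open>The matrix \<open>x I + M\<close> over the polynomials is nonsingular; evaluate its identity at \<open>x = 0\<close>.\<close>
  define N where "N = char_poly_matrix (- M)"
  have N: "N \<in> carrier_mat (Suc (Suc m)) (Suc (Suc m))"
    using M by (simp add: N_def)
  have "det N \<noteq> 0"
    using degree_monic_char_poly[of "- M" "Suc (Suc m)"] M
    unfolding N_def char_poly_def[symmetric] by force
  note dj = desnanot_jacobi_nonsingular[OF N this]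
  have entry: "poly (N $$ (i, j)) 0 = M $$ (i, j)" if "i < Suc (Suc m)" "j < Suc (Suc m)" for i j
    using M that by (auto simp: N_def char_poly_matrix_def)
  have ev: "poly (det (mat l l (\<lambda>(i, j). N $$ (r i, c j)))) 0 = det (mat l l (\<lambda>(i, j). M $$ (r i, c j)))"
    if "\<And>i. i < l \<Longrightarrow> r i < Suc (Suc m)" "\<And>i. i < l \<Longrightarrow> c i < Suc (Suc m)" for l r c
    by (rule poly_det_cong[of _ l]) (use that entry in auto)
  have ev0: "poly (det N) 0 = det M"
    by (rule poly_det_cong[OF M N]) (use entry in auto)
  show ?thesis
    using arg_cong[OF dj, of "\<lambda>p. poly p 0"] ev[of "Suc m" "\<lambda>i. i" "\<lambda>i. i"]
    by (simp add: ev ev0)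
qed

section \<open>Simplicity and positivity of the spectrum\<close>

text \<open>The linear factors of distinct roots are coprime, so their product divides
  \<open>p\<close>; as there are degree many, the quotient is monic of degree
  \<open>0\<close>.\<close>

lemma monic_eq_prod_roots:
  fixes p :: "'a :: idom poly"
  assumes p: "degree p = card R" "lead_coeff p = 1" and R: "finite R" "\<And>x. x \<in> R \<Longrightarrow> poly p x = 0"
  shows "p = (\<Prod>x\<in>R. [:- x, 1:])"
proof -
  have "(\<Prod>x\<in>R. [:- x, 1:]) dvd p"
    using R
  proof (induction rule: finite_induct)
    case (insert x F)
    then obtain q where q: "p = (\<Prod>x\<in>F. [:- x, 1:]) * q" by (auto simp: dvd_def)
    have "poly p x = 0" "poly (\<Prod>x\<in>F. [:- x, 1:]) x \<noteq> 0"
      using insert by (auto simp: poly_prod)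
    then have "[:- x, 1:] dvd q" unfolding q by (simp add: poly_eq_0_iff_dvd)
    then have "[:- x, 1:] * (\<Prod>x\<in>F. [:- x, 1:]) dvd q * (\<Prod>x\<in>F. [:- x, 1:])"
      by (rule mult_dvd_mono[OF _ dvd_refl])
    then show ?case
      unfolding prod.insert[OF insert.hyps] using q by (simp only: mult.commute)
  qed simp
  then obtain q where q: "p = (\<Prod>x\<in>R. [:- x, 1:]) * q" by (auto simp: dvd_def)
  have lc: "lead_coeff (\<Prod>x\<in>R. [:- x, 1:]) = 1" "degree (\<Prod>x\<in>R. [:- x, 1:]) = card R"
    by (simp_all only: lead_coeff_prod) (simp_all add: degree_prod_eq_sum_degree)
  have "lead_coeff q = 1" using p(2) lc(1) unfolding q lead_coeff_mult by (simp only: mult_1)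
  moreover from this have "degree q = 0"
    using p(1) lc unfolding q by (subst (asm) degree_mult_eq) auto
  ultimately have "q = 1" by (auto elim!: degree_eq_zeroE simp: one_pCons)
  then show ?thesis using q by simp
qed

text \<open>The intermediate value theorem puts a root between any two consecutive sample points,
  and these \<open>m\<close> distinct roots already exhaust the degree.\<close>

lemma monic_alternating_sign_roots:
  fixes p :: "real poly"
  assumes p: "degree p = m" "lead_coeff p = 1"
    and b: "\<And>k. k < m \<Longrightarrow> b (Suc k) < b k"
    and sgn: "\<And>k. k \<le> m \<Longrightarrow> 0 < (- 1) ^ k * poly p (b k)"
  obtains \<nu> where "\<And>k. k < m \<Longrightarrow> b (Suc k) < \<nu> k \<and> \<nu> k < b k"
    and "\<And>j k. j < k \<Longrightarrow> k < m \<Longrightarrow> \<nu> k < \<nu> j" and "p = (\<Prod>k<m. [:- \<nu> k, 1:])"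
proof -
  have "\<exists>x. b (Suc k) < x \<and> x < b k \<and> poly p x = 0" if "k < m" for k
  proof -
    have "poly p (b (Suc k)) * poly p (b k) < 0"
      using sgn[of k] sgn[of "Suc k"] that by (cases "even k") (auto simp: mult_less_0_iff)
    then show ?thesis
      using poly_IVT[OF b[OF that], of p] by auto
  qed
  then obtain \<nu> where \<nu>: "\<And>k. k < m \<Longrightarrow> b (Suc k) < \<nu> k \<and> \<nu> k < b k \<and> poly p (\<nu> k) = 0"
    by metis
  have bmono: "b k \<le> b j" if "j \<le> k" "k \<le> m" for j k
    using that
  proof (induction k rule: dec_induct)
    case (step k)
    then show ?case using b[of k] by simp
  qed simp
  have dec: "\<nu> k < \<nu> j" if "j < k" "k < m" for j k
    using \<nu>[of j] \<nu>[of k] bmono[of "Suc j" k] that by simp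
  have inj: "inj_on \<nu> {..<m}"
    by (auto simp: inj_on_def) (metis dec less_irrefl linorder_neqE_nat)
  have "p = (\<Prod>x\<in>\<nu> ` {..<m}. [:- x, 1:])"
    using p \<nu> card_image[OF inj] by (intro monic_eq_prod_roots) auto
  also have "\<dots> = (\<Prod>k<m. [:- \<nu> k, 1:])"
    by (simp add: prod.reindex[OF inj])
  finally show ?thesis using that \<nu> dec by blast
qed

text \<open>
  The last conjunct makes the induction work. By \<open>step\<close>, the sign of \<open>r l\<close> at a root of \<open>q (Suc l)\<close>
  is opposite to that of \<open>q (Suc (Suc l))\<close>, and at a root of \<open>q (Suc (Suc l))\<close> the polynomials
  \<open>r (Suc l)\<close> and \<open>q (Suc l)\<close> have the same sign.
\<close>

lemma interlacing_real_roots: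
  fixes q r :: "nat \<Rightarrow> real poly"
  assumes deg: "\<And>l. degree (q l) = l" and monic: "\<And>l. lead_coeff (q l) = 1" and r0: "r 0 = 1"
    and at0: "\<And>l. l \<le> n \<Longrightarrow> 0 < (- 1) ^ l * poly (q l) 0"
    and step: "\<And>l x. Suc (Suc l) \<le> n \<Longrightarrow> 0 < x \<Longrightarrow>
      poly (q (Suc (Suc l))) x * poly (r l) x < poly (r (Suc l)) x * poly (q (Suc l)) x"
    and l: "Suc l \<le> n"
  shows "\<exists>\<mu>. (\<forall>j k. j < k \<longrightarrow> k \<le> l \<longrightarrow> \<mu> k < \<mu> j) \<and> (\<forall>k\<le>l. 0 < \<mu> k) \<and>
    q (Suc l) = (\<Prod>k<Suc l. [:- \<mu> k, 1:]) \<and> (\<forall>k\<le>l. 0 < (- 1) ^ k * poly (r l) (\<mu> k))"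
  using l
proof (induction l)
  case 0
  define c where "c = coeff (q 1) 0"
  have "q 1 = [:c, 1:]"
    using deg[of 1] monic[of 1]
    by (intro poly_eqI) (auto simp: c_def coeff_pCons coeff_eq_0 split: nat.split)
  moreover have "c < 0" using at0[of 1] 0 \<open>q 1 = _\<close> by simp
  ultimately show ?case by (intro exI[of _ "\<lambda>_. - c"]) (simp add: r0)
next
  case (Suc l)
  then obtain \<mu> where dec: "\<And>j k. j < k \<Longrightarrow> k \<le> l \<Longrightarrow> \<mu> k < \<mu> j" and pos: "\<And>k. k \<le> l \<Longrightarrow> 0 < \<mu> k"
    and q: "q (Suc l) = (\<Prod>k<Suc l. [:- \<mu> k, 1:])"
    and r: "\<And>k. k \<le> l \<Longrightarrow> 0 < (- 1) ^ k * poly (r l) (\<mu> k)"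
    by auto
  let ?P = "q (Suc (Suc l))"
  obtain B where B: "\<And>x. B \<le> x \<Longrightarrow> 1 \<le> poly ?P x"
    using poly_pinfty_gt_lc[of ?P] by (auto simp: monic)
  \<comment> \<open>The sample points for sign changes of \<open>?P\<close>: a point above \<mu> 0
    where \<open>?P\<close> is at least \<open>1\<close>, then the roots of \<open>q (Suc l)\<close>
    in decreasing order, and finally \<open>0\<close>.\<close>
  define b where "b k = (case k of 0 \<Rightarrow> max B (\<mu> 0 + 1) | Suc k \<Rightarrow> if k \<le> l then \<mu> k else 0)" for k
  have b_Suc: "b (Suc k) = \<mu> k" if "k \<le> l" for k using that by (simp add: b_def)
  have b_last: "b (Suc (Suc l)) = 0" by (simp add: b_def)
  have b_dec: "b (Suc k) < b k" if "k < Suc (Suc l)" for k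
    using that dec pos by (auto simp: b_def split: nat.split)
  have neg: "(- 1) ^ k * poly ?P (\<mu> k) < 0" if k: "k \<le> l" for k
  proof -
    have "poly (q (Suc l)) (\<mu> k) = 0"
      unfolding q poly_prod using k by (intro prod_zero) auto
    then have "poly ?P (\<mu> k) * poly (r l) (\<mu> k) < 0"
      using step[OF _ pos[OF k], of l] Suc.prems by simp
    then have "((- 1) ^ k * poly ?P (\<mu> k)) * ((- 1) ^ k * poly (r l) (\<mu> k)) < 0"
      by (cases "even k") (simp_all add: mult.commute)
    then show ?thesis using r[OF k] by (metis mult_less_0_iff less_asym)
  qed
  have sgn: "0 < (- 1) ^ k * poly ?P (b k)" if k: "k \<le> Suc (Suc l)" for k
  proof -
    consider "k = 0" | j where "k = Suc j" "j \<le> l" | "k = Suc (Suc l)"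
      using k by (cases k) (auto simp: le_Suc_eq)
    then show ?thesis
    proof cases
      case 1
      then show ?thesis using B[of "b 0"] by (simp add: b_def)
    next
      case 2
      then show ?thesis using neg[of j] by (simp add: b_Suc)
    next
      case 3
      then show ?thesis using at0[of k] Suc.prems by (simp add: b_last)
    qed
  qed
  obtain \<nu> where \<nu>: "\<And>k. k < Suc (Suc l) \<Longrightarrow> b (Suc k) < \<nu> k \<and> \<nu> k < b k"
    and \<nu>_dec: "\<And>j k. j < k \<Longrightarrow> k < Suc (Suc l) \<Longrightarrow> \<nu> k < \<nu> j"
    and P: "?P = (\<Prod>k<Suc (Suc l). [:- \<nu> k, 1:])"
    using monic_alternating_sign_roots[OF deg monic b_dec sgn] by metis
  have \<nu>_pos: "0 < \<nu> k" if "k \<le> Suc l" for k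
  proof (cases "k \<le> l")
    case True
    then show ?thesis using \<nu>[of k] pos[of k] by (simp add: b_Suc)
  next
    case False
    then have "k = Suc l" using that by simp
    then show ?thesis using \<nu>[of k] by (simp add: b_last)
  qed
  have "0 < (- 1) ^ k * poly (r (Suc l)) (\<nu> k)" if k: "k \<le> Suc l" for k
  proof -
    \<comment> \<open>Exactly the \<open>k\<close> roots \<mu> j with \<open>j < k\<close> lie above
      \<nu> k, so \<open>q (Suc l)\<close> has the sign \<open>(- 1) ^ k\<close> there.\<close>
    have gt: "\<nu> k < \<mu> j" if jk: "j < k" for j
    proof -
      obtain i where i: "k = Suc i" using jk by (cases k) auto
      then have "\<nu> k < \<mu> i" using \<nu>[of k] k b_Suc[of i] by simp
      also have "\<mu> i \<le> \<mu> j" using dec[of j i] jk k i by (cases "i = j") auto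
      finally show ?thesis .
    qed
    have lt: "\<mu> j < \<nu> k" if "k \<le> j" "j \<le> l" for j
    proof -
      have "\<mu> j \<le> \<mu> k" using dec[of k j] that by (cases "k = j") auto
      also have "\<mu> k < \<nu> k" using \<nu>[of k] that b_Suc[of k] by simp
      finally show ?thesis .
    qed
    have "{..<Suc l} = {..<k} \<union> {k..<Suc l}" using k by auto
    then have "poly (q (Suc l)) (\<nu> k) = (\<Prod>j<k. \<nu> k - \<mu> j) * (\<Prod>j=k..<Suc l. \<nu> k - \<mu> j)"
      using prod.union_disjoint[of "{..<k}" "{k..<Suc l}" "\<lambda>j. \<nu> k - \<mu> j"]
      by (simp add: q poly_prod ivl_disj_int del: prod.lessThan_Suc prod.op_ivl_Suc)
    also have "(\<Prod>j<k. \<nu> k - \<mu> j) = (\<Prod>j<k. (- 1) * (\<mu> j - \<nu> k))" by simp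
    also have "\<dots> = (- 1) ^ k * (\<Prod>j<k. \<mu> j - \<nu> k)"
      unfolding prod.distrib by simp
    finally have Q: "poly (q (Suc l)) (\<nu> k) =
        (- 1) ^ k * ((\<Prod>j<k. \<mu> j - \<nu> k) * (\<Prod>j=k..<Suc l. \<nu> k - \<mu> j))"
      by (simp add: mult.assoc)
    have pos': "0 < (\<Prod>j<k. \<mu> j - \<nu> k) * (\<Prod>j=k..<Suc l. \<nu> k - \<mu> j)"
      using gt lt by (intro mult_pos_pos prod_pos) auto
    have "poly ?P (\<nu> k) = 0"
      unfolding P poly_prod using k by (intro prod_zero) (auto simp: less_Suc_eq_le)
    then have "0 < poly (r (Suc l)) (\<nu> k) * poly (q (Suc l)) (\<nu> k)"
      using step[OF _ \<nu>_pos[OF k], of l] Suc.prems by simp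
    then have "0 < ((- 1) ^ k * poly (r (Suc l)) (\<nu> k)) *
        ((\<Prod>j<k. \<mu> j - \<nu> k) * (\<Prod>j=k..<Suc l. \<nu> k - \<mu> j))"
      unfolding Q by (simp only: ac_simps)
    then show ?thesis using pos' by (rule zero_less_mult_pos2)
  qed
  then show ?case
    using \<nu>_dec \<nu>_pos P by (intro exI[of _ \<nu>]) (simp add: less_Suc_eq_le)
qed

text \<open>Desnanot-Jacobi for the leading block of \<open>x I - A\<close>: the difference of the
  two sides is the product of the off-diagonal corner minors. In these \<open>x\<close> stands on
  the superdiagonal or the subdiagonal, so by \<open>det_superdiagonal_shift_pos\<close>, the second
  time for the transpose, both have the sign \<open>(- 1) ^ Suc l\<close>.\<close>

lemma leading_minors_inequality:
  assumes a: "minors_pos n a" and l: "Suc (Suc l) \<le> n" and x: "0 < x"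
  defines "M \<equiv> \<lambda>k r c. mat k k (\<lambda>(i, j). (if r i = c j then x else 0) - a (r i) (c j))"
  shows "det (M (Suc (Suc l)) id id) * det (M l Suc Suc) < det (M (Suc l) Suc Suc) * det (M (Suc l) id id)"
proof -
  let ?N = "M (Suc (Suc l)) id id"
  have pos: "0 < det (mat (Suc l) (Suc l) (\<lambda>(p, q). b (Suc p) (id q) - (if p < l \<and> q = Suc p then x else 0)))"
    if "minors_pos n b" for b
    using l x by (intro det_superdiagonal_shift_pos[OF that]) (auto simp: strict_mono_on_def)
  \<comment> \<open>At size \<open>Suc l\<close> every superdiagonal place satisfies
    \<open>p < l\<close>, so the shift covers the whole superdiagonal.\<close>
  have eq: "mat (Suc l) (Suc l) (\<lambda>(i, j). ?N $$ (Suc i, j)) = (- 1) \<cdot>\<^sub>m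
      mat (Suc l) (Suc l) (\<lambda>(p, q). a (Suc p) (id q) - (if p < l \<and> q = Suc p then x else 0))"
    "mat (Suc l) (Suc l) (\<lambda>(i, j). ?N $$ (i, Suc j)) = (- 1) \<cdot>\<^sub>m (mat (Suc l) (Suc l)
      (\<lambda>(p, q). a (id q) (Suc p) - (if p < l \<and> q = Suc p then x else 0)))\<^sup>T"
    by (auto simp: M_def)
  have "0 < ((- 1) ^ Suc l * d) * ((- 1) ^ Suc l * e)" if "0 < d" "0 < e" for d e :: real
    using that by (cases "even (Suc l)") simp_all
  then have "0 < det (mat (Suc l) (Suc l) (\<lambda>(i, j). ?N $$ (Suc i, j))) *
      det (mat (Suc l) (Suc l) (\<lambda>(i, j). ?N $$ (i, Suc j)))"
    unfolding eq using pos[OF a] pos[OF minors_pos_swap[OF a]]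
    by (simp add: det_transpose[of _ "Suc l"])
  moreover have "mat l l (\<lambda>(i, j). ?N $$ (Suc i, Suc j)) = M l Suc Suc"
    "mat (Suc l) (Suc l) (\<lambda>(i, j). ?N $$ (Suc i, Suc j)) = M (Suc l) Suc Suc"
    "mat (Suc l) (Suc l) (\<lambda>(i, j). ?N $$ (i, j)) = M (Suc l) id id"
    by (auto simp: M_def intro!: eq_matI)
  moreover note desnanot_jacobi[of ?N l]
  ultimately show ?thesis by (simp add: M_def)
qed

text \<open>The characteristic polynomials of the nested blocks satisfy the hypotheses of
  \<open>interlacing_real_roots\<close>: the signs at \<open>0\<close> come from the leading
  principal minors, the inequality from \<open>leading_minors_inequality\<close>.\<close>

lemma totally_positive_simple_spectrum:
  assumes A: "A \<in> carrier_mat n n" and tp: "totally_positive A"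
  shows "card (spectrum A) = n" and "\<And>x. x \<in> spectrum A \<Longrightarrow> 0 < x"
proof -
  define a where "a = (\<lambda>i j. A $$ (i, j))"
  have a: "minors_pos n a"
    using totally_positive_imp_minors_pos[OF A tp] by (simp add: a_def)
  \<comment> \<open>For \<open>l\<close> too large the blocks read entries outside \<open>A\<close>;
    there only the degree and the leading coefficient of \<open>q l\<close> enter.\<close>
  define q where "q l = char_poly (mat l l (\<lambda>(i, j). a i j))" for l
  define r where "r l = char_poly (mat l l (\<lambda>(i, j). a (Suc i) (Suc j)))" for l
  have qA: "q n = char_poly A"
    using A by (auto simp: q_def a_def intro!: arg_cong[where f = char_poly] eq_matI)
  have ev: "poly (char_poly (mat l l f)) x = det (mat l l (\<lambda>(i, j). (if i = j then x else 0) - f (i, j)))"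
    for l f and x :: real
    unfolding char_poly_def by (rule poly_det_cong[of _ l]) (auto simp: char_poly_matrix_def)
  have deg: "degree (q l) = l" "lead_coeff (q l) = 1" for l
    using degree_monic_char_poly[of "mat l l (\<lambda>(i, j). a i j)" l] by (auto simp: q_def)
  have r0: "r 0 = 1" by (simp add: r_def char_poly_def det_dim_zero)
  have at0: "0 < (- 1) ^ l * poly (q l) 0" if "l \<le> n" for l
  proof -
    have "mat l l (\<lambda>(i, j). (if i = j then 0 else 0) - a i j) = (- 1) \<cdot>\<^sub>m mat l l (\<lambda>(i, j). a i j)"
      by auto
    then have "poly (q l) 0 = (- 1) ^ l * det (mat l l (\<lambda>(i, j). a i j))"
      by (simp add: q_def ev)
    moreover have "0 < det (mat l l (\<lambda>(i, j). a (id i) (id j)))"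
      using a that unfolding minors_pos_def by (force simp: strict_mono_on_def)
    ultimately show ?thesis by (simp flip: power_mult_distrib mult.assoc)
  qed
  have step: "poly (q (Suc (Suc l))) x * poly (r l) x < poly (r (Suc l)) x * poly (q (Suc l)) x"
    if "Suc (Suc l) \<le> n" "0 < x" for l x
    using leading_minors_inequality[OF a that] by (simp add: q_def r_def ev)
  have "\<exists>\<mu>. inj_on \<mu> {..<n} \<and> (\<forall>k<n. 0 < \<mu> k) \<and> char_poly A = (\<Prod>k<n. [:- \<mu> k, 1:])"
  proof (cases n)
    case 0
    then show ?thesis using qA deg(1)[of 0] deg(2)[of 0] by (auto elim!: degree_eq_zeroE)
  next
    case (Suc l)
    have "Suc l \<le> n" using Suc by simp
    with interlacing_real_roots[of q r n l] deg r0 at0 step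
    have "\<exists>\<mu>. (\<forall>j k. j < k \<longrightarrow> k \<le> l \<longrightarrow> \<mu> k < \<mu> j) \<and> (\<forall>k\<le>l. 0 < \<mu> k) \<and>
      q (Suc l) = (\<Prod>k<Suc l. [:- \<mu> k, 1:]) \<and> (\<forall>k\<le>l. 0 < (- 1) ^ k * poly (r l) (\<mu> k))"
      by blast
    then obtain \<mu> where \<mu>: "\<And>j k. j < k \<Longrightarrow> k \<le> l \<Longrightarrow> \<mu> k < \<mu> j" "\<And>k. k \<le> l \<Longrightarrow> 0 < \<mu> k"
      "q (Suc l) = (\<Prod>k<Suc l. [:- \<mu> k, 1:])"
      by blast
    have "inj_on \<mu> {..<n}"
      by (auto simp: inj_on_def Suc less_Suc_eq_le) (metis \<mu>(1) less_irrefl linorder_neqE_nat)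
    then show ?thesis using \<mu> qA Suc by (auto simp: less_Suc_eq_le)
  qed
  then obtain \<mu> where inj: "inj_on \<mu> {..<n}" and pos: "\<forall>k<n. 0 < \<mu> k"
    and cp: "char_poly A = (\<Prod>k<n. [:- \<mu> k, 1:])" by blast
  have spec: "spectrum A = \<mu> ` {..<n}"
    unfolding spectrum_root_char_poly[OF A] cp by (auto simp: poly_prod)
  show "card (spectrum A) = n" using card_image[OF inj] spec by simp
  show "0 < x" if "x \<in> spectrum A" for x using that spec pos by auto
qed

section \<open>Monotonicity and continuity of the largest eigenvalue\<close>

definition mat_trace :: "'a :: comm_monoid_add mat \<Rightarrow> 'a" where
  "mat_trace A = (\<Sum>i<dim_row A. A $$ (i, i))"

lemma mat_trace_mult_commute:
  fixes A B :: "'a :: comm_semiring_0 mat"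
  assumes A: "A \<in> carrier_mat n m" and B: "B \<in> carrier_mat m n"
  shows "mat_trace (A * B) = mat_trace (B * A)"
proof -
  have "mat_trace (A * B) = (\<Sum>i<n. \<Sum>j<m. A $$ (i, j) * B $$ (j, i))"
    using A B by (auto simp: mat_trace_def scalar_prod_def atLeast0LessThan intro!: sum.cong)
  also have "\<dots> = (\<Sum>j<m. \<Sum>i<n. B $$ (j, i) * A $$ (i, j))"
    by (subst sum.swap) (simp add: mult.commute)
  also have "\<dots> = mat_trace (B * A)"
    using A B by (auto simp: mat_trace_def scalar_prod_def atLeast0LessThan intro!: sum.cong)
  finally show ?thesis .
qed

lemma mat_trace_similar:
  fixes A B :: "'a :: comm_semiring_1 mat"
  assumes "similar_mat_wit A B P Q"
  shows "mat_trace A = mat_trace B"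
proof -
  define n where "n = dim_row A"
  note sim = similar_mat_witD[OF n_def assms]
  have "mat_trace A = mat_trace (P * (B * Q))"
    using sim by (simp add: assoc_mult_mat[of _ n n _ n _ n])
  also have "\<dots> = mat_trace (B * Q * P)"
    using sim by (intro mat_trace_mult_commute[of _ n n]) auto
  also have "B * Q * P = B"
    using sim by (simp add: assoc_mult_mat[of _ n n _ n _ n])
  finally show ?thesis .
qed

lemma upper_triangular_pow:
  fixes B :: "'a :: comm_semiring_1 mat"
  assumes B: "B \<in> carrier_mat n n" and ut: "upper_triangular B"
  shows "upper_triangular (B ^\<^sub>m k) \<and> (\<forall>i<n. (B ^\<^sub>m k) $$ (i, i) = (B $$ (i, i)) ^ k)"
proof (induction k)
  case 0
  then show ?case using B by auto
next
  case (Suc k)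
  have C: "B ^\<^sub>m k \<in> carrier_mat n n" using B by simp
  have entry: "(B ^\<^sub>m Suc k) $$ (i, j) = (\<Sum>l<n. (B ^\<^sub>m k) $$ (i, l) * B $$ (l, j))"
    if "i < n" "j < n" for i j
    using B C that by (simp add: scalar_prod_def atLeast0LessThan)
  have zero: "(B ^\<^sub>m k) $$ (i, l) = 0" if "l < i" "i < n" for i l
    using Suc.IH C that by auto
  have zero': "B $$ (i, l) = 0" if "l < i" "i < n" for i l
    using ut B that by auto
  have "(B ^\<^sub>m Suc k) $$ (i, j) = 0" if "j < i" "i < n" for i j
    unfolding entry[OF that(2) less_trans[OF that]]
  proof (intro sum.neutral ballI)
    fix l assume "l \<in> {..<n}"
    then show "(B ^\<^sub>m k) $$ (i, l) * B $$ (l, j) = 0"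
      using zero[of l i] zero'[of j l] that by (cases "l < i") auto
  qed
  moreover have "(B ^\<^sub>m Suc k) $$ (i, i) = B $$ (i, i) ^ Suc k" if "i < n" for i
  proof -
    have "(B ^\<^sub>m Suc k) $$ (i, i) = (\<Sum>l<n. if l = i then (B ^\<^sub>m k) $$ (i, i) * B $$ (i, i) else 0)"
      unfolding entry[OF that that]
    proof (intro sum.cong refl)
      fix l assume "l \<in> {..<n}"
      then show "(B ^\<^sub>m k) $$ (i, l) * B $$ (l, i) = (if l = i then (B ^\<^sub>m k) $$ (i, i) * B $$ (i, i) else 0)"
        using zero[of l i] zero'[of i l] that by (cases l i rule: linorder_cases) auto
    qed
    then show ?thesis using Suc.IH that by (simp add: mult.commute)
  qed
  ultimately show ?case using B by (auto simp: upper_triangular_def)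
qed

text \<open>With \<open>n\<close> distinct real eigenvalues the characteristic polynomial splits, so
  \<open>A\<close> is similar to a real upper triangular matrix with the eigenvalues on the
  diagonal. Similarity preserves the trace, and powers of a triangular matrix act entrywise on its
  diagonal.\<close>

lemma mat_trace_pow_eq_power_sum:
  fixes A :: "real mat"
  assumes A: "A \<in> carrier_mat n n" and card: "card (spectrum A) = n"
  shows "mat_trace (A ^\<^sub>m k) = (\<Sum>x\<in>spectrum A. x ^ k)"
proof -
  define es where "es = sorted_list_of_set (spectrum A)"
  have fin: "finite (spectrum A)" using card_finite_spectrum[OF A] by simp
  have es: "set es = spectrum A" "distinct es" using fin by (simp_all add: es_def)
  have "char_poly A = (\<Prod>x\<in>spectrum A. [:- x, 1:])"
    using degree_monic_char_poly[OF A] card fin spectrum_root_char_poly[OF A]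
    by (intro monic_eq_prod_roots) auto
  also have "\<dots> = (\<Prod>e\<leftarrow>es. [:- e, 1:])"
    using es by (metis prod.distinct_set_conv_list)
  finally have cp: "char_poly A = (\<Prod>e\<leftarrow>es. [:- e, 1:])" .
  obtain B P Q where dec: "schur_decomposition A es = (B, P, Q)"
    by (cases "schur_decomposition A es") auto
  from schur_decomposition[OF A cp dec]
  have sim: "similar_mat_wit A B P Q" and ut: "upper_triangular B" and diag: "diag_mat B = es"
    by auto
  have B: "B \<in> carrier_mat n n" using similar_mat_witD2[OF A sim] by simp
  have "mat_trace (A ^\<^sub>m k) = mat_trace (B ^\<^sub>m k)"
    by (rule mat_trace_similar[OF similar_mat_wit_pow[OF sim]])
  also have "\<dots> = (\<Sum>i<n. B $$ (i, i) ^ k)"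
    using upper_triangular_pow[OF B ut, of k] B by (simp add: mat_trace_def)
  also have "\<dots> = (\<Sum>e\<leftarrow>diag_mat B. e ^ k)"
    using B by (simp add: diag_mat_def sum_list_sum_nth atLeast0LessThan)
  also have "\<dots> = (\<Sum>x\<in>spectrum A. x ^ k)"
    unfolding diag using es by (metis sum.distinct_set_conv_list)
  finally show ?thesis .
qed

lemma mat_pow_entries_le:
  fixes M N :: "real mat"
  assumes M: "M \<in> carrier_mat n n" and N: "N \<in> carrier_mat n n"
    and le: "\<And>i j. i < n \<Longrightarrow> j < n \<Longrightarrow> 0 \<le> M $$ (i, j) \<and> M $$ (i, j) \<le> c * N $$ (i, j)"
    and "i < n" "j < n"
  shows "0 \<le> (M ^\<^sub>m k) $$ (i, j) \<and> (M ^\<^sub>m k) $$ (i, j) \<le> c ^ k * (N ^\<^sub>m k) $$ (i, j)"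
  using assms(4,5)
proof (induction k arbitrary: i j)
  case 0
  then show ?case using M N by simp
next
  case (Suc k)
  have Mk: "M ^\<^sub>m k \<in> carrier_mat n n" "N ^\<^sub>m k \<in> carrier_mat n n" using M N by simp_all
  have entry: "(M ^\<^sub>m Suc k) $$ (i, j) = (\<Sum>l<n. (M ^\<^sub>m k) $$ (i, l) * M $$ (l, j))"
    "(N ^\<^sub>m Suc k) $$ (i, j) = (\<Sum>l<n. (N ^\<^sub>m k) $$ (i, l) * N $$ (l, j))"
    using M N Mk Suc.prems by (simp_all add: scalar_prod_def atLeast0LessThan)
  have "(\<Sum>l<n. (M ^\<^sub>m k) $$ (i, l) * M $$ (l, j)) \<le>
      (\<Sum>l<n. (c ^ k * (N ^\<^sub>m k) $$ (i, l)) * (c * N $$ (l, j)))"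
  proof (intro sum_mono mult_mono)
    fix l assume "l \<in> {..<n}"
    then show "(M ^\<^sub>m k) $$ (i, l) \<le> c ^ k * (N ^\<^sub>m k) $$ (i, l)" "M $$ (l, j) \<le> c * N $$ (l, j)"
      "0 \<le> c ^ k * (N ^\<^sub>m k) $$ (i, l)" "0 \<le> M $$ (l, j)"
      using Suc.IH[of i l] le[of l j] Suc.prems by auto
  qed
  also have "\<dots> = c ^ Suc k * (\<Sum>l<n. (N ^\<^sub>m k) $$ (i, l) * N $$ (l, j))"
    by (simp add: sum_distrib_left mult_ac)
  finally have "(M ^\<^sub>m Suc k) $$ (i, j) \<le> c ^ Suc k * (N ^\<^sub>m Suc k) $$ (i, j)"
    unfolding entry .
  moreover have "0 \<le> (M ^\<^sub>m Suc k) $$ (i, j)"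
    unfolding entry using Suc.IH le Suc.prems by (intro sum_nonneg mult_nonneg_nonneg) auto
  ultimately show ?case by simp
qed

text \<open>A constant factor cannot make up for geometric growth of the ratio
  \<open>(x / y) ^ k\<close>.\<close>

lemma le_if_powers_le:
  fixes x y :: real
  assumes y: "0 \<le> y" and le: "\<And>k. x ^ k \<le> real n * y ^ k"
  shows "x \<le> y"
proof (rule ccontr)
  assume "\<not> x \<le> y"
  then have xy: "y < x" by simp
  show False
  proof (cases "y = 0")
    case True
    then show ?thesis using le[of 1] xy by simp
  next
    case False
    with y have y: "0 < y" by simp
    have "1 < x / y" using xy y by simp
    then obtain k where "real n < (x / y) ^ k"
      using real_arch_pow by blast
    then have "real n * y ^ k < x ^ k"
      using y by (simp add: power_divide field_simps)
    then show False using le[of k] by simp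
  qed
qed

text \<open>Write \<open>x\<close> and \<open>y\<close> for the two maxima. As the spectra are
  positive, \<open>x ^ k\<close> is at most the trace of the \<open>k\<close>-th power of
  \<open>M\<close>, hence at most \<open>c ^ k\<close> times that of \<open>N\<close>, hence at most
  \<open>n * (c * y) ^ k\<close>; now let \<open>k\<close> grow. The choice \<open>c = 1\<close>
  gives monotonicity, \<open>c\<close> close to \<open>1\<close> continuity.\<close>

lemma Max_spectrum_le:
  fixes M N :: "real mat"
  assumes n: "0 < n" and M: "M \<in> carrier_mat n n" and N: "N \<in> carrier_mat n n"
    and le: "\<And>i j. i < n \<Longrightarrow> j < n \<Longrightarrow> 0 \<le> M $$ (i, j) \<and> M $$ (i, j) \<le> c * N $$ (i, j)"
    and c: "0 \<le> c"
    and specM: "card (spectrum M) = n" "\<And>x. x \<in> spectrum M \<Longrightarrow> 0 < x"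
    and specN: "card (spectrum N) = n" "\<And>x. x \<in> spectrum N \<Longrightarrow> 0 < x"
  shows "Max (spectrum M) \<le> c * Max (spectrum N)"
proof -
  have fin: "finite (spectrum M)" "finite (spectrum N)" using card_finite_spectrum M N by blast+
  have ne: "spectrum M \<noteq> {}" "spectrum N \<noteq> {}" using n specM(1) specN(1) by auto
  let ?x = "Max (spectrum M)" and ?y = "Max (spectrum N)"
  have y: "0 < ?y" using Max_in[OF fin(2) ne(2)] specN(2) by blast
  have "?x ^ k \<le> real n * (c * ?y) ^ k" for k
  proof -
    have "mat_trace (N ^\<^sub>m k) = (\<Sum>x\<in>spectrum N. x ^ k)"
      by (rule mat_trace_pow_eq_power_sum[OF N specN(1)])
    also have "\<dots> \<le> (\<Sum>x\<in>spectrum N. ?y ^ k)"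
      using specN(2) fin by (intro sum_mono power_mono) (auto intro: less_imp_le)
    finally have traceN: "mat_trace (N ^\<^sub>m k) \<le> real n * ?y ^ k" using specN(1) by simp
    have "?x ^ k = (\<Sum>x\<in>{?x}. x ^ k)" by simp
    also have "\<dots> \<le> (\<Sum>x\<in>spectrum M. x ^ k)"
      using specM(2) fin Max_in[OF fin(1) ne(1)] by (intro sum_mono2) (auto intro: less_imp_le)
    also have "\<dots> = mat_trace (M ^\<^sub>m k)"
      by (rule mat_trace_pow_eq_power_sum[OF M specM(1), symmetric])
    also have "\<dots> \<le> c ^ k * mat_trace (N ^\<^sub>m k)"
      using mat_pow_entries_le[OF M N le] M N
      by (auto simp: mat_trace_def sum_distrib_left intro!: sum_mono)
    also have "\<dots> \<le> c ^ k * (real n * ?y ^ k)"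
      using c traceN by (intro mult_left_mono) auto
    finally show ?thesis by (simp add: power_mult_distrib mult_ac)
  qed
  moreover have "0 \<le> c * ?y" using c y by simp
  ultimately show ?thesis by (rule le_if_powers_le[rotated])
qed

text \<open>
  Close positive matrices bound each other entrywise up to a factor close to \<open>1\<close>, and hence so do
  their largest eigenvalues.
\<close>

lemma continuous_on_Max_spectrum:
  fixes M :: "real \<Rightarrow> real mat"
  assumes n: "0 < n" and M: "\<And>t. t \<in> T \<Longrightarrow> M t \<in> carrier_mat n n"
    and pos: "\<And>t i j. t \<in> T \<Longrightarrow> i < n \<Longrightarrow> j < n \<Longrightarrow> 0 < M t $$ (i, j)"
    and cont: "\<And>i j. i < n \<Longrightarrow> j < n \<Longrightarrow> continuous_on T (\<lambda>t. M t $$ (i, j))"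
    and spec: "\<And>t. t \<in> T \<Longrightarrow> card (spectrum (M t)) = n" "\<And>t x. t \<in> T \<Longrightarrow> x \<in> spectrum (M t) \<Longrightarrow> 0 < x"
  shows "continuous_on T (\<lambda>t. Max (spectrum (M t)))"
  unfolding continuous_on_def
proof
  fix s assume s: "s \<in> T"
  define f where "f t = Max (spectrum (M t))" for t
  \<comment> \<open>The sum of all relative errors bounds every ratio of entries, and it vanishes
    when the two matrices coincide.\<close>
  define c where "c u t = 1 + (\<Sum>i<n. \<Sum>j<n. \<bar>M t $$ (i, j) / M u $$ (i, j) - 1\<bar>)" for u t
  have c_pos: "1 \<le> c u t" for u t by (simp add: c_def sum_nonneg)
  have le: "f t \<le> c u t * f u" if "t \<in> T" "u \<in> T" for t u
    unfolding f_def
  proof (rule Max_spectrum_le[OF n M[OF that(1)] M[OF that(2)]])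
    fix i j assume ij: "i < n" "j < n"
    have "M t $$ (i, j) / M u $$ (i, j) - 1 \<le> \<bar>M t $$ (i, j) / M u $$ (i, j) - 1\<bar>" by simp
    also have "\<dots> \<le> (\<Sum>j<n. \<bar>M t $$ (i, j) / M u $$ (i, j) - 1\<bar>)"
      using ij by (intro member_le_sum) auto
    also have "\<dots> \<le> (\<Sum>i<n. \<Sum>j<n. \<bar>M t $$ (i, j) / M u $$ (i, j) - 1\<bar>)"
      using ij by (intro member_le_sum[where f = "\<lambda>i. \<Sum>j<n. \<bar>M t $$ (i, j) / M u $$ (i, j) - 1\<bar>"])
        (auto simp: sum_nonneg)
    finally have "M t $$ (i, j) / M u $$ (i, j) \<le> c u t" by (simp add: c_def)
    then show "0 \<le> M t $$ (i, j) \<and> M t $$ (i, j) \<le> c u t * M u $$ (i, j)"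
      using pos[OF that(1) ij] pos[OF that(2) ij] by (simp add: field_simps)
  qed (use c_pos[of u t] spec that in auto)
  have M_lim: "((\<lambda>t. M t $$ (i, j)) \<longlongrightarrow> M s $$ (i, j)) (at s within T)" if "i < n" "j < n" for i j
    using cont[OF that] s by (simp add: continuous_on_def)
  have nz: "M s $$ (i, j) \<noteq> 0" if "i < n" "j < n" for i j
    using pos[OF s that] by simp
  \<comment> \<open>Both orders of the arguments are needed: \<open>c s t\<close> bounds
    \<open>f t\<close> from above and \<open>c t s\<close> bounds it from below, and both tend to
    \<open>1\<close>.\<close>
  have "((\<lambda>t. c s t) \<longlongrightarrow> 1 + (\<Sum>i<n. \<Sum>j<n. \<bar>M s $$ (i, j) / M s $$ (i, j) - 1\<bar>)) (at s within T)"
    unfolding c_def by (intro tendsto_intros M_lim nz) auto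
  then have upper: "((\<lambda>t. c s t * f s) \<longlongrightarrow> f s) (at s within T)"
    using nz by (auto intro!: tendsto_eq_intros)
  have "((\<lambda>t. c t s) \<longlongrightarrow> 1 + (\<Sum>i<n. \<Sum>j<n. \<bar>M s $$ (i, j) / M s $$ (i, j) - 1\<bar>)) (at s within T)"
    unfolding c_def by (intro tendsto_intros M_lim nz) auto
  then have lower: "((\<lambda>t. f s / c t s) \<longlongrightarrow> f s) (at s within T)"
    using nz by (auto intro!: tendsto_eq_intros)
  show "((\<lambda>t. Max (spectrum (M t))) \<longlongrightarrow> Max (spectrum (M s))) (at s within T)"
    unfolding f_def[symmetric]
  proof (rule tendsto_sandwich[OF _ _ lower upper])
    show "\<forall>\<^sub>F t in at s within T. f s / c t s \<le> f t"
      unfolding eventually_at_filter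
    proof (intro always_eventually allI impI)
      fix t assume "t \<in> T"
      then show "f s / c t s \<le> f t"
        using le[OF s] c_pos[of t s] by (simp add: divide_le_eq mult.commute)
    qed
    show "\<forall>\<^sub>F t in at s within T. f t \<le> c s t * f s"
      unfolding eventually_at_filter using le s by (intro always_eventually) auto
  qed
qed

section \<open>The checkerboard order and the conjugated inverse\<close>

text \<open>For square matrices this is conjugation by \<open>alternating_diag\<close>; the
  entrywise form makes the signs explicit.\<close>

definition checkerboard :: "real mat \<Rightarrow> real mat" where
  "checkerboard A = mat (dim_row A) (dim_col A) (\<lambda>(i, j). (- 1) ^ (i + j) * A $$ (i, j))"

lemma checkerboard_carrier [simp]:
  "A \<in> carrier_mat n m \<Longrightarrow> checkerboard A \<in> carrier_mat n m"
  by (simp add: checkerboard_def)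

lemma checkerboard_index:
  "A \<in> carrier_mat n m \<Longrightarrow> i < n \<Longrightarrow> j < m \<Longrightarrow> checkerboard A $$ (i, j) = (- 1) ^ (i + j) * A $$ (i, j)"
  by (simp add: checkerboard_def)

lemma alternating_diag_conj:
  assumes "A \<in> carrier_mat n n"
  shows "alternating_diag n * A * alternating_diag n = checkerboard A"
  using assms unfolding alternating_diag_def checkerboard_def
  by (subst mat_diag_mult_left, assumption, subst mat_diag_mult_right[of _ n])
    (auto intro!: eq_matI simp: power_add)

lemma alternating_diag_square: "alternating_diag n * alternating_diag n = 1\<^sub>m n"
  by (simp add: alternating_diag_def flip: power_mult_distrib)

lemma alternating_diag_carrier: "alternating_diag n \<in> carrier_mat n n"
  by (simp add: alternating_diag_def)

lemma similar_mat_checkerboard: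
  assumes A: "A \<in> carrier_mat n n"
  shows "similar_mat (checkerboard A) A"
  unfolding similar_mat_def
  by (intro exI, rule similar_mat_witI[OF alternating_diag_square alternating_diag_square])
    (use A in \<open>auto simp: alternating_diag_conj alternating_diag_carrier\<close>)

lemma spectrum_checkerboard:
  assumes A: "A \<in> carrier_mat n n"
  shows "spectrum (checkerboard A) = spectrum A"
  using char_poly_similar[OF similar_mat_checkerboard[OF A]]
  by (simp add: spectrum_root_char_poly[OF A] spectrum_root_char_poly[OF checkerboard_carrier[OF A]])

lemma checkerboard_mult:
  assumes A: "A \<in> carrier_mat n n" and B: "B \<in> carrier_mat n n"
  shows "checkerboard (A * B) = checkerboard A * checkerboard B"
proof (rule eq_matI)
  fix i j assume "i < dim_row (checkerboard A * checkerboard B)" "j < dim_col (checkerboard A * checkerboard B)"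
  then have ij: "i < n" "j < n" using A B by (auto simp: checkerboard_def)
  have sgn: "(- 1) ^ (i + k) * a * ((- 1) ^ (k + j) * b) = (- 1) ^ (i + j) * (a * b)" for k and a b :: real
    by (cases "even k") (simp_all add: power_add)
  have "checkerboard (A * B) $$ (i, j) = (\<Sum>k<n. (- 1) ^ (i + j) * (A $$ (i, k) * B $$ (k, j)))"
    using A B ij by (simp add: checkerboard_def scalar_prod_def atLeast0LessThan sum_distrib_left)
  also have "\<dots> = (checkerboard A * checkerboard B) $$ (i, j)"
    using A B ij by (simp add: checkerboard_def scalar_prod_def atLeast0LessThan sgn)
  finally show "checkerboard (A * B) $$ (i, j) = (checkerboard A * checkerboard B) $$ (i, j)" .
qed (use A B in \<open>auto simp: checkerboard_def\<close>)

lemma checkerboard_one [simp]: "checkerboard (1\<^sub>m n) = 1\<^sub>m n"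
  by (rule eq_matI) (auto simp: checkerboard_def)

text \<open>The explicit formula exhibits the entries of the inverse as quotients of minors, from
  which both their signs and their continuity can be read off.\<close>

definition adj_inverse :: "real mat \<Rightarrow> real mat" where
  "adj_inverse A = (1 / det A) \<cdot>\<^sub>m adj_mat A"

lemma adj_inverse:
  assumes A: "A \<in> carrier_mat n n" and nz: "det A \<noteq> 0"
  shows "adj_inverse A \<in> carrier_mat n n" "A * adj_inverse A = 1\<^sub>m n" "adj_inverse A * A = 1\<^sub>m n"
proof -
  note adj = adj_mat[OF A]
  show "adj_inverse A \<in> carrier_mat n n" using adj by (simp add: adj_inverse_def)
  have one: "(1 / det A) \<cdot>\<^sub>m (det A \<cdot>\<^sub>m 1\<^sub>m n) = 1\<^sub>m n"
    using nz by (intro eq_matI) auto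
  show "A * adj_inverse A = 1\<^sub>m n"
    unfolding adj_inverse_def using mult_smult_distrib[OF A adj(1)] adj(2) one by simp
  show "adj_inverse A * A = 1\<^sub>m n"
    unfolding adj_inverse_def using mult_smult_assoc_mat[OF adj(1) A] adj(3) one by simp
qed

text \<open>Eigenvectors of \<open>A\<close> are eigenvectors of the inverse for the reciprocal
  eigenvalues. This yields \<open>n\<close> distinct eigenvalues, which leaves no room for
  others.\<close>

lemma spectrum_adj_inverse:
  assumes A: "A \<in> carrier_mat n n" and nz: "det A \<noteq> 0" and card: "card (spectrum A) = n"
    and pos: "\<And>x. x \<in> spectrum A \<Longrightarrow> 0 < x"
  shows "spectrum (adj_inverse A) = inverse ` spectrum A"
proof -
  note inv = adj_inverse[OF A nz]
  have "inverse x \<in> spectrum (adj_inverse A)" if x: "x \<in> spectrum A" for x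
  proof -
    obtain v where v: "v \<in> carrier_vec n" "v \<noteq> 0\<^sub>v n" "A *\<^sub>v v = x \<cdot>\<^sub>v v"
      using x A by (auto simp: spectrum_def eigenvalue_def eigenvector_def)
    have "v = adj_inverse A *\<^sub>v (A *\<^sub>v v)"
      using assoc_mult_mat_vec[OF inv(1) A v(1)] inv(3) v(1) by simp
    also have "\<dots> = x \<cdot>\<^sub>v (adj_inverse A *\<^sub>v v)"
      unfolding v(3) using inv(1) v(1) by (rule mult_mat_vec)
    finally have "inverse x \<cdot>\<^sub>v v = inverse x \<cdot>\<^sub>v (x \<cdot>\<^sub>v (adj_inverse A *\<^sub>v v))" by simp
    also have "\<dots> = adj_inverse A *\<^sub>v v"
      using pos[OF x] inv(1) v(1) by (simp add: smult_smult_assoc)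
    finally show ?thesis
      using v inv(1) by (auto simp: spectrum_def eigenvalue_def eigenvector_def)
  qed
  then have sub: "inverse ` spectrum A \<subseteq> spectrum (adj_inverse A)" by auto
  have "card (inverse ` spectrum A) = n"
    using card by (subst card_image) (auto intro: inj_onI)
  then show ?thesis
    using card_finite_spectrum[OF inv(1)] sub by (metis card_seteq)
qed

text \<open>By the cofactor formula an entry of the inverse is \<open>(- 1) ^ (i + j)\<close> times
  a quotient of positive minors, and the conjugation cancels the sign.\<close>

lemma totally_positive_checkerboard_inverse_pos:
  assumes A: "A \<in> carrier_mat n n" and tp: "totally_positive A"
  shows "0 < det A"
    and "i < n \<Longrightarrow> j < n \<Longrightarrow> 0 < checkerboard (adj_inverse A) $$ (i, j)"
proof -
  have a: "minors_pos n (\<lambda>i j. A $$ (i, j))"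
    by (rule totally_positive_imp_minors_pos[OF A tp])
  have "0 < det (mat n n (\<lambda>(i, j). A $$ (id i, id j)))"
    using a unfolding minors_pos_def by (force simp: strict_mono_on_def)
  moreover have "mat n n (\<lambda>(i, j). A $$ (id i, id j)) = A"
    using A by (intro eq_matI) auto
  ultimately show det: "0 < det A" by simp
  assume ij: "i < n" "j < n"
  then obtain m where n: "n = Suc m" by (cases n) auto
  have "mat_delete A j i = mat m m (\<lambda>(p, q). A $$ (insert_index j p, insert_index i q))"
    using A by (intro eq_matI) (auto simp: n mat_delete_def insert_index_def)
  moreover have "0 < det (mat m m (\<lambda>(p, q). A $$ (insert_index j p, insert_index i q)))"
    using a insert_index_strict_mono_on[of m id] insert_index_image_subset[of id m n]
    unfolding minors_pos_def n by (simp add: strict_mono_on_def)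
  ultimately have "0 < det (mat_delete A j i)" by simp
  moreover have "checkerboard (adj_inverse A) $$ (i, j) = det (mat_delete A j i) / det A"
    using A ij by (cases "even (i + j)")
      (simp_all add: checkerboard_def adj_inverse_def adj_mat_def cofactor_def add.commute)
  ultimately show "0 < checkerboard (adj_inverse A) $$ (i, j)" using det by simp
qed

text \<open>After conjugation all three factors on the right of the resolvent identity are entrywise
  nonnegative.\<close>

lemma checkerboard_inverse_antimono:
  assumes A: "A \<in> carrier_mat n n" "totally_positive A" and B: "B \<in> carrier_mat n n" "totally_positive B"
    and le: "\<And>i j. i < n \<Longrightarrow> j < n \<Longrightarrow> (- 1) ^ (i + j) * A $$ (i, j) \<le> (- 1) ^ (i + j) * B $$ (i, j)"
    and ij: "i < n" "j < n"
  shows "checkerboard (adj_inverse B) $$ (i, j) \<le> checkerboard (adj_inverse A) $$ (i, j)"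
proof -
  define SA SB where "SA = checkerboard (adj_inverse A)" and "SB = checkerboard (adj_inverse B)"
  define E where "E = checkerboard B - checkerboard A"
  have detA: "det A \<noteq> 0" and detB: "det B \<noteq> 0"
    using totally_positive_checkerboard_inverse_pos(1)[OF A]
      totally_positive_checkerboard_inverse_pos(1)[OF B] by simp_all
  note invA = adj_inverse[OF A(1) detA] and invB = adj_inverse[OF B(1) detB]
  have carr: "SA \<in> carrier_mat n n" "SB \<in> carrier_mat n n" "E \<in> carrier_mat n n"
    "checkerboard A \<in> carrier_mat n n" "checkerboard B \<in> carrier_mat n n"
    using invA invB A B by (auto simp: SA_def SB_def E_def intro: minus_carrier_mat)
  have one: "SA * checkerboard A = 1\<^sub>m n" "checkerboard B * SB = 1\<^sub>m n"
    unfolding SA_def SB_def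
    by (simp_all add: checkerboard_mult[OF invA(1) A(1), symmetric]
        checkerboard_mult[OF B(1) invB(1), symmetric] invA(3) invB(2))
  have E: "E $$ (k, l) = (- 1) ^ (k + l) * B $$ (k, l) - (- 1) ^ (k + l) * A $$ (k, l)"
    if "k < n" "l < n" for k l
    using carrier_matD[OF carr(4)] checkerboard_index[OF A(1) that] checkerboard_index[OF B(1) that] that
    by (simp add: E_def)
  \<comment> \<open>The resolvent identity \<open>A\<^sup>-\<^sup>1 - B\<^sup>-\<^sup>1 = A\<^sup>-\<^sup>1 (B - A) B\<^sup>-\<^sup>1\<close>, conjugated.\<close>
  have "SA * E * SB = (SA * checkerboard B - 1\<^sub>m n) * SB"
    unfolding E_def using carr one by (simp add: mult_minus_distrib_mat)
  also have "\<dots> = SA * (checkerboard B * SB) - SB"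
    using carr by (subst minus_mult_distrib_mat[of _ n n _ _ n]) (auto simp: assoc_mult_mat[of _ n n _ n _ n])
  also have "\<dots> = SA - SB" using carr one by simp
  finally have "SA $$ (i, j) - SB $$ (i, j) = (SA * E * SB) $$ (i, j)"
    using carr ij by simp
  also have "\<dots> = (\<Sum>k<n. SA $$ (i, k) * (\<Sum>l<n. E $$ (k, l) * SB $$ (l, j)))"
    using carr ij by (simp add: scalar_prod_def atLeast0LessThan)
  also have "0 \<le> \<dots>"
  proof (intro sum_nonneg mult_nonneg_nonneg)
    fix k l assume "l \<in> {..<n}" "k \<in> {..<n}"
    then show "0 \<le> SA $$ (i, k)" "0 \<le> SB $$ (l, j)" "0 \<le> E $$ (k, l)"
      using totally_positive_checkerboard_inverse_pos(2)[OF A ij(1), of k]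
        totally_positive_checkerboard_inverse_pos(2)[OF B _ ij(2), of l] le[of k l] E[of k l]
      by (auto simp: SA_def SB_def)
  qed
  finally show ?thesis by (simp add: SA_def SB_def)
qed

section \<open>Extreme eigenvalues over an interval\<close>

lemma eig_eq_Max_Min:
  assumes n: "1 \<le> n" and card: "card (spectrum A) = n"
  shows "eig 1 A = Max (spectrum A)" and "eig n A = Min (spectrum A)"
proof -
  let ?xs = "sorted_list_of_set (spectrum A)"
  have fin: "finite (spectrum A)" using card n by (metis card.infinite not_one_le_zero)
  have ne: "spectrum A \<noteq> {}" using card n by auto
  have xs: "length ?xs = n" "set ?xs = spectrum A" "sorted ?xs" using card fin by simp_all
  have nth: "?xs ! k \<in> spectrum A" if "k < n" for k
    using xs that by (metis nth_mem)
  have *: "\<exists>k<n. x = ?xs ! k" if "x \<in> spectrum A" for x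
    using xs that by (metis in_set_conv_nth)
  have "eig 1 A = ?xs ! (n - 1)"
    using xs n by (simp add: eig_def rev_nth)
  also have "\<dots> = Max (spectrum A)"
    using nth[of "n - 1"] n xs
    by (intro Max_eqI[symmetric] fin) (auto dest!: * intro!: sorted_nth_mono)
  finally show "eig 1 A = Max (spectrum A)" .
  have "eig n A = ?xs ! 0"
    using xs n by (simp add: eig_def rev_nth)
  also have "\<dots> = Min (spectrum A)"
    using nth[of 0] n xs
    by (intro Min_eqI[symmetric] fin) (auto dest!: * intro!: sorted_nth_mono)
  finally show "eig n A = Min (spectrum A)" .
qed

text \<open>The smallest eigenvalue of \<open>A\<close> becomes the largest one of the entrywise
  positive matrix \<open>S\<close>, to which the results on \<open>Max (spectrum S)\<close>
  apply.\<close>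

lemma Min_spectrum_eq:
  assumes n: "1 \<le> n" and A: "A \<in> carrier_mat n n" "totally_positive A"
  defines "S \<equiv> checkerboard (adj_inverse A)"
  shows "S \<in> carrier_mat n n" "card (spectrum S) = n" "\<And>x. x \<in> spectrum S \<Longrightarrow> 0 < x"
    and "Min (spectrum A) = inverse (Max (spectrum S))" and "0 < Max (spectrum S)"
proof -
  note spec = totally_positive_simple_spectrum[OF A]
  have det: "det A \<noteq> 0" using totally_positive_checkerboard_inverse_pos(1)[OF A] by simp
  note inv = adj_inverse[OF A(1) det]
  have S: "spectrum S = inverse ` spectrum A"
    unfolding S_def using spectrum_checkerboard[OF inv(1)] spectrum_adj_inverse[OF A(1) det spec] by simp
  show "S \<in> carrier_mat n n" using inv by (simp add: S_def)
  show "card (spectrum S) = n"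
    using spec(1) unfolding S by (subst card_image) (auto intro: inj_onI)
  show Spos: "0 < x" if "x \<in> spectrum S" for x using that spec(2) by (auto simp: S)
  have fin: "finite (spectrum A)" using card_finite_spectrum[OF A(1)] by simp
  have ne: "spectrum A \<noteq> {}" using spec(1) n by auto
  have "inverse x \<le> inverse (Min (spectrum A))" if "x \<in> spectrum A" for x
    by (rule le_imp_inverse_le[OF Min_le[OF fin that] spec(2)[OF Min_in[OF fin ne]]])
  then have "Max (spectrum S) = inverse (Min (spectrum A))"
    unfolding S using fin ne by (intro Max_eqI) auto
  then show "Min (spectrum A) = inverse (Max (spectrum S))" by simp
  show "0 < Max (spectrum S)"
    using fin ne Spos unfolding S by (intro Spos[unfolded S] Max_in) auto
qed

text \<open>The order is reversed twice: by passing to the conjugated inverse and by taking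
  reciprocals of the largest eigenvalues.\<close>

lemma Min_spectrum_mono:
  assumes n: "1 \<le> n" and A: "A \<in> carrier_mat n n" "totally_positive A"
    and B: "B \<in> carrier_mat n n" "totally_positive B"
    and le: "\<And>i j. i < n \<Longrightarrow> j < n \<Longrightarrow> (- 1) ^ (i + j) * A $$ (i, j) \<le> (- 1) ^ (i + j) * B $$ (i, j)"
  shows "Min (spectrum A) \<le> Min (spectrum B)"
proof -
  note SA = Min_spectrum_eq[OF n A] and SB = Min_spectrum_eq[OF n B]
  have "Max (spectrum (checkerboard (adj_inverse B))) \<le> 1 * Max (spectrum (checkerboard (adj_inverse A)))"
    using n checkerboard_inverse_antimono[OF A B le] totally_positive_checkerboard_inverse_pos(2)[OF B]
    by (intro Max_spectrum_le[OF _ SB(1) SA(1) _ _ SB(2,3) SA(2,3)]) (auto intro: less_imp_le)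
  then show ?thesis using SA(4,5) SB(4,5) by (simp add: le_imp_inverse_le)
qed

section \<open>Continuity of determinants and inverses\<close>

lemma continuous_on_det:
  fixes M :: "'a :: topological_space \<Rightarrow> real mat"
  assumes M: "\<And>t. M t \<in> carrier_mat n n"
    and cont: "\<And>i j. i < n \<Longrightarrow> j < n \<Longrightarrow> continuous_on T (\<lambda>t. M t $$ (i, j))"
  shows "continuous_on T (\<lambda>t. det (M t))"
  unfolding det_def'[OF M]
proof (intro continuous_on_sum continuous_on_mult continuous_on_const continuous_on_prod)
  fix p i assume "p \<in> {p. p permutes {0..<n}}" "i \<in> {0..<n}"
  then show "continuous_on T (\<lambda>t. M t $$ (i, p i))"
    by (intro cont) (auto dest: permutes_in_image[of p _ i])
qed

lemma continuous_on_checkerboard_inverse: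
  assumes M: "\<And>t. M t \<in> carrier_mat n n" and nz: "\<And>t. t \<in> T \<Longrightarrow> det (M t) \<noteq> 0"
    and cont: "\<And>i j. i < n \<Longrightarrow> j < n \<Longrightarrow> continuous_on T (\<lambda>t. M t $$ (i, j))"
    and ij: "i < n" "j < n"
  shows "continuous_on T (\<lambda>t. checkerboard (adj_inverse (M t)) $$ (i, j))"
proof -
  have eq: "checkerboard (adj_inverse (M t)) $$ (i, j) =
      (- 1) ^ (i + j) * ((1 / det (M t)) * ((- 1) ^ (j + i) * det (mat_delete (M t) j i)))" for t
    using M[of t] ij by (simp add: checkerboard_def adj_inverse_def adj_mat_def cofactor_def)
  have "continuous_on T (\<lambda>t. det (mat_delete (M t) j i))"
  proof (rule continuous_on_det)
    show "mat_delete (M t) j i \<in> carrier_mat (n - 1) (n - 1)" for t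
      by (rule mat_delete_carrier[OF M])
    fix p q assume "p < n - 1" "q < n - 1"
    then have "mat_delete (M t) j i $$ (p, q) = M t $$ (insert_index j p, insert_index i q)"
      and "insert_index j p < n" "insert_index i q < n" for t
      using M[of t] by (auto simp: mat_delete_def insert_index_def)
    then show "continuous_on T (\<lambda>t. mat_delete (M t) j i $$ (p, q))"
      using cont by simp
  qed
  then show ?thesis
    unfolding eq using nz by (intro continuous_intros continuous_on_det[OF M cont]) auto
qed

section \<open>Interval matrices and segments inside them\<close>

lemma interval_matD:
  fixes L U :: "real mat"
  assumes "L \<in> carrier_mat n n" "A \<in> {L..U}"
  shows "A \<in> carrier_mat n n"
    and "i < n \<Longrightarrow> j < n \<Longrightarrow> L $$ (i, j) \<le> A $$ (i, j) \<and> A $$ (i, j) \<le> U $$ (i, j)"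
  using assms by (auto simp: less_eq_mat_def)

lemma interval_matI:
  fixes L U :: "real mat"
  assumes "L \<in> carrier_mat n n" "U \<in> carrier_mat n n" "A \<in> carrier_mat n n"
    and "\<And>i j. i < n \<Longrightarrow> j < n \<Longrightarrow> L $$ (i, j) \<le> A $$ (i, j) \<and> A $$ (i, j) \<le> U $$ (i, j)"
  shows "A \<in> {L..U}"
  using assms by (auto simp: less_eq_mat_def)

definition segment_mat :: "real mat \<Rightarrow> real mat \<Rightarrow> real \<Rightarrow> real mat" where
  "segment_mat X Y t = (1 - t) \<cdot>\<^sub>m X + t \<cdot>\<^sub>m Y"

text \<open>The interval matrix is convex, so it contains the segment from \<open>X\<close> to
  \<open>Y\<close>, and the intermediate value theorem along it attains every value between the
  extremes. Keeping \<open>g\<close> abstract serves both extreme eigenvalues.\<close>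

lemma interval_mat_range_eq:
  fixes g :: "real mat \<Rightarrow> real"
  assumes L: "L \<in> carrier_mat n n" and U: "U \<in> carrier_mat n n"
    and X: "X \<in> {L..U}" and Y: "Y \<in> {L..U}"
    and bounds: "\<And>A. A \<in> {L..U} \<Longrightarrow> g X \<le> g A \<and> g A \<le> g Y"
    and cont: "\<And>M. (\<And>t. M t \<in> carrier_mat n n) \<Longrightarrow> (\<And>t. t \<in> {0..1} \<Longrightarrow> M t \<in> {L..U}) \<Longrightarrow>
      (\<And>i j. i < n \<Longrightarrow> j < n \<Longrightarrow> continuous_on {0..1} (\<lambda>t. M t $$ (i, j))) \<Longrightarrow>
      continuous_on {0..1::real} (\<lambda>t. g (M t))"
  shows "{g A | A. A \<in> {L..U}} = {g X..g Y}"
proof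
  show "{g A | A. A \<in> {L..U}} \<subseteq> {g X..g Y}" using bounds by auto
  note XD = interval_matD[OF L X] and YD = interval_matD[OF L Y]
  let ?M = "segment_mat X Y"
  have carr: "?M t \<in> carrier_mat n n" for t
    using XD(1) YD(1) by (simp add: segment_mat_def)
  have entry: "?M t $$ (i, j) = (1 - t) * X $$ (i, j) + t * Y $$ (i, j)" if "i < n" "j < n" for t i j
    using XD(1) YD(1) that by (simp add: segment_mat_def)
  have mem: "?M t \<in> {L..U}" if t: "t \<in> {0..1}" for t
  proof (rule interval_matI[OF L U carr])
    fix i j assume ij: "i < n" "j < n"
    \<comment> \<open>\<open>convex_bound_le\<close> yields upper bounds; the lower bound comes from
      its instance for the negated entries.\<close>
    have "(1 - t) * X $$ (i, j) + t * Y $$ (i, j) \<in> {L $$ (i, j)..U $$ (i, j)}"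
      using XD(2)[OF ij] YD(2)[OF ij] t
        convex_bound_le[of "X $$ (i, j)" "U $$ (i, j)" "Y $$ (i, j)" "1 - t" t]
        convex_bound_le[of "- X $$ (i, j)" "- L $$ (i, j)" "- Y $$ (i, j)" "1 - t" t] by auto
    then show "L $$ (i, j) \<le> ?M t $$ (i, j) \<and> ?M t $$ (i, j) \<le> U $$ (i, j)"
      using entry[OF ij] by simp
  qed
  have ends: "?M 0 = X" "?M 1 = Y"
    using carr XD(1) YD(1) entry by (auto intro!: eq_matI)
  have "continuous_on {0..1} (\<lambda>t. g (?M t))"
    by (rule cont[OF carr mem]) (simp_all add: entry continuous_intros)
  then have "\<exists>t\<ge>0. t \<le> 1 \<and> g (?M t) = y" if "y \<in> {g X..g Y}" for y
    using that ends by (intro IVT'[of "\<lambda>t. g (?M t)"]) auto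
  then show "{g X..g Y} \<subseteq> {g A | A. A \<in> {L..U}}"
    using mem by (force simp del: atLeastAtMost_iff simp: atLeastAtMost_iff[of _ 0 1])
qed

lemma totally_positive_entry_pos:
  assumes A: "A \<in> carrier_mat n n" "totally_positive A" and ij: "i < n" "j < n"
  shows "0 < A $$ (i, j)"
proof -
  have "0 < det (mat 1 1 (\<lambda>(p, q). A $$ ((\<lambda>_. i) p, (\<lambda>_. j) q)))"
    using totally_positive_imp_minors_pos[OF A] ij unfolding minors_pos_def
    by (force simp: strict_mono_on_def)
  then show ?thesis by (simp add: det_single)
qed

theorem theorem14:
  fixes n :: nat and L U :: "real mat"
  assumes "n \<ge> 1"
    and "L \<in> carrier_mat n n" and "U \<in> carrier_mat n n"
    and "L \<le> U"
    and "totally_positive_interval L U"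
  shows "eig_range n L U = {eig n (down_mat L U)..eig n (up_mat L U)}
       \<and> eig_range 1 L U = {eig 1 L..eig 1 U}"
proof
  note n = assms(1) and L = assms(2) and U = assms(3)
  have tp: "totally_positive A" if "A \<in> {L..U}" for A
    using assms(5) that by (simp add: totally_positive_interval_def)
  have carr: "A \<in> carrier_mat n n" if "A \<in> {L..U}" for A
    using interval_matD(1)[OF L that] .
  have LU: "L $$ (i, j) \<le> U $$ (i, j)" if "i < n" "j < n" for i j
    using assms(4) U that by (simp add: less_eq_mat_def)
  have eig: "eig 1 A = Max (spectrum A)" "eig n A = Min (spectrum A)" if "A \<in> {L..U}" for A
    using eig_eq_Max_Min[OF n] totally_positive_simple_spectrum(1)[OF carr tp] that by blast+
  have spec: "card (spectrum A) = n" "\<And>x. x \<in> spectrum A \<Longrightarrow> 0 < x" if "A \<in> {L..U}" for A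
    using totally_positive_simple_spectrum[OF carr[OF that] tp[OF that]] by blast+

  have memL: "L \<in> {L..U}" and memU: "U \<in> {L..U}" using assms(4) by auto
  have "{eig 1 A | A. A \<in> {L..U}} = {eig 1 L..eig 1 U}"
  proof (rule interval_mat_range_eq[OF L U memL memU])
    fix A assume A: "A \<in> {L..U}"
    have "Max (spectrum B) \<le> 1 * Max (spectrum C)"
      if "B \<in> {L..U}" "C \<in> {L..U}" "\<And>i j. i < n \<Longrightarrow> j < n \<Longrightarrow> B $$ (i, j) \<le> C $$ (i, j)" for B C
      using n that spec totally_positive_entry_pos[OF carr tp] carr
      by (intro Max_spectrum_le[of n]) (auto simp del: atLeastAtMost_iff intro: less_imp_le)
    from this[OF memL A] this[OF A memU]
    show "eig 1 L \<le> eig 1 A \<and> eig 1 A \<le> eig 1 U"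
      using interval_matD(2)[OF L A] eig A memL memU by simp
  next
    fix M :: "real \<Rightarrow> real mat"
    assume M: "\<And>t. M t \<in> carrier_mat n n" "\<And>t. t \<in> {0..1} \<Longrightarrow> M t \<in> {L..U}"
      and cont: "\<And>i j. i < n \<Longrightarrow> j < n \<Longrightarrow> continuous_on {0..1} (\<lambda>t. M t $$ (i, j))"
    have "continuous_on {0..1} (\<lambda>t. Max (spectrum (M t)))"
      using n totally_positive_entry_pos[OF M(1) tp[OF M(2)]] spec(1)[OF M(2)] M(1) cont
      by (intro continuous_on_Max_spectrum[of n])
        (auto simp del: atLeastAtMost_iff intro: spec(2)[OF M(2)])
    \<comment> \<open>On \<open>{0..1}\<close> the path stays in the interval, where
      \<open>eig 1\<close> is the maximum of the spectrum.\<close>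
    then show "continuous_on {0..1} (\<lambda>t. eig 1 (M t))"
      by (rule iffD1[OF continuous_on_cong[OF refl], rotated]) (rule eig(1)[OF M(2), symmetric])
  qed
  then show "eig_range 1 L U = {eig 1 L..eig 1 U}" by (simp add: eig_range_def)

  let ?D = "down_mat L U" and ?U = "up_mat L U"
  have radius: "radius_mat L U \<in> carrier_mat n n"
    using minus_carrier_mat[OF L, of U] by (simp add: radius_mat_def)
  have dim: "dim_row L = n" using L by simp
  have DU: "?D \<in> carrier_mat n n" "?U \<in> carrier_mat n n"
    unfolding down_mat_def up_mat_def dim alternating_diag_conj[OF radius]
    by (intro minus_carrier_mat add_carrier_mat checkerboard_carrier radius)+
  \<comment> \<open>This makes \<open>?D\<close> the least and \<open>?U\<close> the greatest
    element of the interval in the checkerboard order.\<close>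
  have entries: "?D $$ (i, j) = (if even (i + j) then L $$ (i, j) else U $$ (i, j))"
    "?U $$ (i, j) = (if even (i + j) then U $$ (i, j) else L $$ (i, j))" if "i < n" "j < n" for i j
  proof -
    have mid: "midpoint_mat L U $$ (i, j) = (L $$ (i, j) + U $$ (i, j)) / 2"
      using L U that by (simp add: midpoint_mat_def)
    have rad: "checkerboard (radius_mat L U) $$ (i, j) = (- 1) ^ (i + j) * ((U $$ (i, j) - L $$ (i, j)) / 2)"
      using L U that unfolding checkerboard_index[OF radius that] by (simp add: radius_mat_def)
    note [simp] = carrier_matD[OF checkerboard_carrier[OF radius]]
    have "?D $$ (i, j) = midpoint_mat L U $$ (i, j) - checkerboard (radius_mat L U) $$ (i, j)"
      "?U $$ (i, j) = midpoint_mat L U $$ (i, j) + checkerboard (radius_mat L U) $$ (i, j)"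
      unfolding down_mat_def up_mat_def dim alternating_diag_conj[OF radius] using that by simp_all
    then show "?D $$ (i, j) = (if even (i + j) then L $$ (i, j) else U $$ (i, j))"
      "?U $$ (i, j) = (if even (i + j) then U $$ (i, j) else L $$ (i, j))"
      unfolding mid rad by (cases "even (i + j)"; simp add: field_simps)+
  qed
  have memD: "?D \<in> {L..U}" and memUp: "?U \<in> {L..U}"
    using LU by (auto intro!: interval_matI[OF L U] DU simp: entries simp del: atLeastAtMost_iff)
  have "{eig n A | A. A \<in> {L..U}} = {eig n ?D..eig n ?U}"
  proof (rule interval_mat_range_eq[OF L U memD memUp])
    fix A assume A: "A \<in> {L..U}"
    have "Min (spectrum ?D) \<le> Min (spectrum A)" "Min (spectrum A) \<le> Min (spectrum ?U)"
      using interval_matD(2)[OF L A]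
      by (auto intro!: Min_spectrum_mono[OF n] carr tp A memD memUp simp: entries simp del: atLeastAtMost_iff)
    then show "eig n ?D \<le> eig n A \<and> eig n A \<le> eig n ?U"
      using eig A memD memUp by simp
  next
    fix M :: "real \<Rightarrow> real mat"
    assume M: "\<And>t. M t \<in> carrier_mat n n" "\<And>t. t \<in> {0..1} \<Longrightarrow> M t \<in> {L..U}"
      and cont: "\<And>i j. i < n \<Longrightarrow> j < n \<Longrightarrow> continuous_on {0..1} (\<lambda>t. M t $$ (i, j))"
    let ?S = "\<lambda>t. checkerboard (adj_inverse (M t))"
    note S = Min_spectrum_eq[OF n M(1) tp[OF M(2)]]
      and pos = totally_positive_checkerboard_inverse_pos[OF M(1) tp[OF M(2)]]
    have "det (M t) \<noteq> 0" if "t \<in> {0..1}" for t using pos(1)[OF that] by simp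
    then have "continuous_on {0..1} (\<lambda>t. Max (spectrum (?S t)))"
      using n S pos(2) continuous_on_checkerboard_inverse[OF M(1) _ cont]
      by (intro continuous_on_Max_spectrum[of n]) (auto simp del: atLeastAtMost_iff)
    \<comment> \<open>Taking reciprocals returns to the smallest eigenvalue of \<open>M t\<close>;
      the maximum is positive, so continuity survives.\<close>
    then have "continuous_on {0..1} (\<lambda>t. inverse (Max (spectrum (?S t))))"
      using less_imp_neq[OF S(5), symmetric] by (intro continuous_on_inverse ballI) simp_all
    then show "continuous_on {0..1} (\<lambda>t. eig n (M t))"
      by (rule iffD1[OF continuous_on_cong[OF refl], rotated]) (simp only: eig(2)[OF M(2)] S(4))
  qed
  then show "eig_range n L U = {eig n ?D..eig n ?U}" by (simp add: eig_range_def)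
qed

end
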